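(* Let $d\ge1$ be an integer. Let $s$ be a positive real. For all probability measures $\nu$ on $(0,+\infty)$, the following assertions are equivalent: 1. the moment $\int r^{d+s}\,\nu(dr)$ is finite; 2. there exists $\lambda_0>0$ such that $E_{\lambda,\nu}(D^s)$ is finite for all positive real numbers $\lambda<\lambda_0$. Moreover, there exists a positive constant $C$ that depends only on the dimension $d$ (in particular, not on $s$ or $\nu$) such that, for all positive real $s$ and all probability measures $\nu$ on $(0,+\infty)$, if the previous assertions hold, then $$E_{\lambda,\nu}(D^s)\text{ is finite for all positive real numbers } \lambda<C\left(\int r^d\,\nu(dr)\right)^{-1}.$$
   Context: Fix an integer $d\ge1$. $|\cdot|$ is Lebesgue measure on $\mathbb{R}^d$, $\|\cdot\|$ the Euclidean norm, and $B(x,r)$ the open Euclidean ball centered at $x\in\mathbb{R}^d$ with radius $r\ge 0$. For $\lambda>0$ and a probability measure $\nu$ on $(0,+\infty)$, let $\xi$ be a Poisson point process on $\mathbb{R}^d\times(0,+\infty)$ whose intensity measure is the product of $\lambda|\cdot|$ and $\nu$; $P_{\lambda,\nu}$ and $E_{\lambda,\nu}$ denote the associated probability measure and expectation. As distinct points of $\xi$ have distinct coordinates in $\mathbb{R}^d$ (almost surely), write $\xi=\{(c,r(c)) : c\in\chi\}$, where $\chi$ is the projection of $\xi$ on $\mathbb{R}^d$ (a Poisson point process on $\mathbb{R}^d$ with intensity $\lambda|\cdot|$; conditionally on $\chi$, the radii $r(c)$, $c\in\chi$, are i.i.d. with law $\nu$). Let $\Sigma=\bigcup_{c\in\chi}B(c,r(c))$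 and let $S$ be the connected component of $\Sigma$ which contains $0$, with $S=\varnothing$ if $0\notin\Sigma$. $D=\sup_{x,y\in S}\|x-y\|\in[0,+\infty]$ is the Euclidean diameter of $S$, with $D=0$ if $S$ is empty. *)

theory Defs
  imports "HOL-Probability.Probability"
begin

text \<open>
  Poisson point processes with intensity measure \<open>\<mu>\<close>, as random sets of points. Only intensities
  without atoms are used here, and for those the process is almost surely simple, so that
  the random set carries the same information as the random counting measure.
  Counts are cardinalities with values in \<open>[0, \<infinity>]\<close>; the Poisson law with parameter
  \<open>\<infinity>\<close> is the Dirac mass at \<open>\<infinity>\<close>.
\<close>

definition num_points :: "'b set \<Rightarrow> 'b set \<Rightarrow> ennreal" where
  "num_points X A = emeasure (count_space UNIV) (X \<inter> A)"

definition poisson_process :: "'w measure \<Rightarrow> ('w \<Rightarrow> 'b set) \<Rightarrow> 'b measure \<Rightarrow> bool" where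
  "poisson_process M \<xi> \<mu> \<longleftrightarrow>
     prob_space M \<and>
     (\<forall>\<omega>\<in>space M. \<xi> \<omega> \<subseteq> space \<mu>) \<and>
     (\<forall>A\<in>sets \<mu>. (\<lambda>\<omega>. num_points (\<xi> \<omega>) A) \<in> borel_measurable M) \<and>
     (\<forall>A\<in>sets \<mu>. emeasure \<mu> A < \<infinity> \<longrightarrow>
        (\<forall>k::nat. measure M {\<omega> \<in> space M. num_points (\<xi> \<omega>) A = of_nat k}
                   = measure \<mu> A ^ k / fact k * exp (- measure \<mu> A))) \<and>
     (\<forall>A\<in>sets \<mu>. emeasure \<mu> A = \<infinity> \<longrightarrow> (AE \<omega> in M. num_points (\<xi> \<omega>) A = \<infinity>)) \<and>
     (\<forall>(n::nat) A. (\<forall>i<n. A i \<in> sets \<mu>) \<longrightarrow> disjoint_family_on A {..<n} \<longrightarrow>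
        prob_space.indep_vars M (\<lambda>_. borel) (\<lambda>i \<omega>. num_points (\<xi> \<omega>) (A i)) {..<n})"

text \<open>Probability measures on \<open>(0, \<infinity>)\<close>; the first equation forces \<open>space \<nu> = {0<..}\<close>.\<close>

definition radius_law :: "real measure \<Rightarrow> bool" where
  "radius_law \<nu> \<longleftrightarrow> sets \<nu> = sets (restrict_space borel {0<..}) \<and> prob_space \<nu>"

definition intensity :: "real \<Rightarrow> real measure \<Rightarrow> ((real ^ 'd) \<times> real) measure" where
  "intensity lam \<nu> = scale_measure (ennreal lam) lborel \<Otimes>\<^sub>M \<nu>"

text \<open>
  The Poisson process of the Boolean model is realised on a space of configurations of
  (centre, radius) pairs, with the process itself being the identity. The sigma-algebra may be any
  one that makes the point counts measurable.
\<close>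

definition boolean_model ::
  "((real ^ 'd) \<times> real) set measure \<Rightarrow> real \<Rightarrow> real measure \<Rightarrow> bool" where
  "boolean_model P lam \<nu> \<longleftrightarrow> poisson_process P (\<lambda>\<xi>. \<xi>) (intensity lam \<nu>)"

definition occupied :: "((real ^ 'd) \<times> real) set \<Rightarrow> (real ^ 'd) set" where
  "occupied \<xi> = (\<Union>(c, r)\<in>\<xi>. ball c r)"

text \<open>Empty if \<open>0\<close> is not occupied, by the library's convention.\<close>

definition cluster :: "((real ^ 'd) \<times> real) set \<Rightarrow> (real ^ 'd) set" where
  "cluster \<xi> = connected_component_set (occupied \<xi>) 0"

text \<open>The library's \<^const>\<open>diameter\<close> is real-valued, with value \<open>0\<close> on unbounded sets.\<close>

definition cluster_diameter :: "((real ^ 'd) \<times> real) set \<Rightarrow> ennreal" where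
  "cluster_diameter \<xi> = (SUP x\<in>cluster \<xi>. SUP y\<in>cluster \<xi>. ennreal (norm (x - y)))"

text \<open>Powers of elements of \<open>[0, \<infinity>]\<close>, for positive exponents only.\<close>

definition ennreal_powr :: "ennreal \<Rightarrow> real \<Rightarrow> ennreal" where
  "ennreal_powr x s = (if x = \<infinity> then \<infinity> else ennreal (enn2real x powr s))"

text \<open>
  \<open>E(D\<^sup>s)\<close> under \<open>P\<close>. The cluster diameter is measurable up to a null set (the configurations that
  are not locally finite), on which the value of \<^const>\<open>nn_integral\<close> does not depend.
\<close>

definition diameter_moment :: "((real ^ 'd) \<times> real) set measure \<Rightarrow> real \<Rightarrow> ennreal" where
  "diameter_moment P s = (\<integral>\<^sup>+ \<xi>. ennreal_powr (cluster_diameter \<xi>) s \<partial>P)"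

definition radius_moment :: "real measure \<Rightarrow> real \<Rightarrow> ennreal" where
  "radius_moment \<nu> p = (\<integral>\<^sup>+ r. ennreal (r powr p) \<partial>\<nu>)"

end

theory Submission
  imports Defs
begin

text \<open>
  Moments of the radius give moments of the diameter by a renormalisation of scales. Write
  \<open>\<pi>(\<alpha>)\<close> for the supremum, over all \<open>x\<close>, of the probability that a chain of overlapping balls leads from
  distance at most \<open>\<alpha>\<close> of \<open>x\<close> to distance at least \<open>2\<alpha>\<close>, using only balls with centres within
  \<open>3\<alpha>\<close> of \<open>x\<close> and radii below \<open>\<alpha>/2\<close>. A crossing at scale \<open>10\<alpha>\<close> either meets a ball of radius of
  order \<open>\<alpha>\<close> or more, or contains two crossings at scale \<open>\<alpha>\<close>, one at each of its ends. The ends are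
  so far apart that these two look at disjoint parts of the process, hence are independent, and
  their centres can be taken in a finite net of fixed size \<open>N\<close>. So
  \<open>\<pi>(10\<alpha>) \<le> N\<^sup>2 \<pi>(\<alpha>)\<^sup>2 + e(\<alpha>)\<close>, where \<open>e(\<alpha>)\<close> is of order \<open>\<lambda> \<integral> r\<^sup>d 1(r \<ge> \<alpha>/4) \<nu>(dr)\<close>
  (\<open>crosses_two_scales\<close>, \<open>prob_crossing_rec\<close>). At a small enough initial scale there is
  probably no point at all (\<open>prob_crossing_base\<close>), and a bound on \<open>\<lambda> \<integral> r\<^sup>d \<nu>(dr)\<close> in terms
  of \<open>N\<close> and \<open>d\<close> keeps the error term small at every scale. The quadratic recursion then makes
  \<open>\<pi>(10\<^sup>n \<alpha>)\<close> decay as fast as the error allows (\<open>scale_bound_summable\<close>), and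
  \<open>\<Sum> 10\<^bsup>ns\<^esup> e(10\<^sup>n \<alpha>)\<close> is at most a multiple of the moment of order \<open>d + s\<close> (\<open>suminf_giants\<close>). If the
  diameter exceeds \<open>6\<alpha>\<close>, then there is a crossing at scale \<open>\<alpha>\<close> around \<open>0\<close> or a ball of radius
  at least comparable to both \<open>\<alpha>\<close> and its distance to \<open>0\<close> (\<open>cluster_diameter_le\<close>); summing over
  the scales bounds \<open>E(D\<^sup>s)\<close>.

  A Poisson process is described only by its counts in fixed sets: they are measurable, have Poisson
  laws and are independent for finitely many disjoint sets. To obtain events of this kind, \<open>\<real>\<^sup>d \<times> (0, \<infinity>)\<close> is cut into
  countably many cells of diameter at most \<open>2\<eta>\<close>, and all balls whose centre and radius lie in one
  cell are replaced by a single larger ball. Crossings of the resulting set of balls depend only on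
  which cells are occupied. Since \<open>\<eta>\<close> is a small fraction of the initial scale, the enlargement is
  harmless at all scales. The larger balls cover the original ones, which is the direction needed
  for an upper bound. The diameter itself is only ever compared, pointwise, with
  measurable functions.

  Conversely, let \<open>E(D\<^sup>s)\<close> be finite. A ball of radius \<open>r\<close> that contains \<open>0\<close> forces \<open>D \<ge> r/2\<close>. The mean number of such
  balls with \<open>r \<ge> 1\<close> is finite, because otherwise \<open>D\<close> would be almost surely infinite; hence with
  probability bounded below by a multiple of the mean number in the layer \<open>[2\<^sup>n, 2\<^bsup>n+1\<^esup>)\<close>, exactly
  one such ball is present and its radius lies in that layer (\<open>single_layer_event\<close>). Summing
  \<open>2\<^bsup>ns\<^esup>\<close> times these probabilities recovers the moment of order \<open>d + s\<close>
  (\<open>radius_moment_finite\<close>).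
\<close>

section \<open>Chains of overlapping balls\<close>

text \<open>
  The balls reachable from a ball around \<open>x\<close> and the remaining balls have disjoint open unions,
  and a connected set cannot meet both. This turns the topological cluster into a
  combinatorial object.
\<close>

lemma connected_cover_chain:
  fixes B :: "'i \<Rightarrow> 'b::topological_space set"
  assumes op: "\<And>i. i \<in> I \<Longrightarrow> open (B i)"
    and y: "y \<in> connected_component_set (\<Union>i\<in>I. B i) x"
  shows "\<exists>a\<in>I. \<exists>b\<in>I. x \<in> B a \<and> y \<in> B b \<and>
           (a, b) \<in> {(i, j). i \<in> I \<and> j \<in> I \<and> B i \<inter> B j \<noteq> {}}\<^sup>*"
proof -
  define R where "R = {(i, j). i \<in> I \<and> j \<in> I \<and> B i \<inter> B j \<noteq> {}}"
  obtain S where S: "connected S" "S \<subseteq> (\<Union>i\<in>I. B i)" "x \<in> S" "y \<in> S"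
    using y unfolding connected_component_def by auto
  then obtain a where a: "a \<in> I" "x \<in> B a" by auto
  \<comment> \<open>The balls that can, respectively cannot, be reached from \<open>a\<close>.\<close>
  define V where "V = (\<Union>i\<in>{i\<in>I. (a, i) \<in> R\<^sup>*}. B i)"
  define W where "W = (\<Union>i\<in>{i\<in>I. (a, i) \<notin> R\<^sup>*}. B i)"
  have "open V" "open W" unfolding V_def W_def using op by auto
  moreover have "V \<inter> W = {}"
  proof (rule ccontr)
    assume "V \<inter> W \<noteq> {}"
    then obtain i j where "i \<in> I" "j \<in> I" "(a, i) \<in> R\<^sup>*" "(a, j) \<notin> R\<^sup>*" "B i \<inter> B j \<noteq> {}"
      unfolding V_def W_def by blast
    moreover from this have "(i, j) \<in> R" by (auto simp: R_def)
    ultimately show False by (meson rtrancl.rtrancl_into_rtrancl)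
  qed
  moreover have "S \<subseteq> V \<union> W" using S(2) unfolding V_def W_def by blast
  ultimately have "V \<inter> S = {} \<or> W \<inter> S = {}"
    using connectedD[OF S(1)] by (metis Int_empty_left)
  moreover have "x \<in> V" using a by (auto simp: V_def)
  ultimately have "y \<in> V" using S \<open>S \<subseteq> V \<union> W\<close> by blast
  then show ?thesis using a unfolding V_def R_def by auto
qed

definition link :: "('i \<Rightarrow> 'b::metric_space) \<Rightarrow> ('i \<Rightarrow> real) \<Rightarrow> 'i set \<Rightarrow> ('i \<times> 'i) set" where
  "link c \<rho> Q = {(a, b). a \<in> Q \<and> b \<in> Q \<and> dist (c a) (c b) < \<rho> a + \<rho> b}"

definition near :: "('i \<Rightarrow> 'b::metric_space) \<Rightarrow> ('i \<Rightarrow> real) \<Rightarrow> 'b \<Rightarrow> real \<Rightarrow> 'i set" where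
  "near c \<rho> x \<alpha> = {a. dist (c a) x \<le> 3 * \<alpha> \<and> \<rho> a < \<alpha> / 2}"

text \<open>
  The restriction to \<^const>\<open>near\<close> makes a crossing depend only on balls centred close to \<open>x\<close>, which is
  where independence comes from. The bound on the radii makes the centres move by less than
  \<open>\<alpha>\<close> in each step, so that positions of centres can stand for positions of balls.
\<close>

definition crosses :: "('i \<Rightarrow> 'b::metric_space) \<Rightarrow> ('i \<Rightarrow> real) \<Rightarrow> 'b \<Rightarrow> real \<Rightarrow> 'i set \<Rightarrow> bool" where
  "crosses c \<rho> x \<alpha> Q \<longleftrightarrow> (\<exists>a b. dist (c a) x \<le> \<alpha> \<and> 2 * \<alpha> \<le> dist (c b) x \<and>
     (a, b) \<in> (link c \<rho> (Q \<inter> near c \<rho> x \<alpha>))\<^sup>*)"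

lemma link_mono: "Q \<subseteq> Q' \<Longrightarrow> link c \<rho> Q \<subseteq> link c \<rho> Q'"
  by (auto simp: link_def)

lemma crosses_mono: "crosses c \<rho> x \<alpha> Q \<Longrightarrow> Q \<subseteq> Q' \<Longrightarrow> crosses c \<rho> x \<alpha> Q'"
  unfolding crosses_def
  by (meson Int_mono link_mono order_refl rtrancl_mono subsetD)

lemma crosses_Int: "crosses c \<rho> x \<alpha> Q \<longleftrightarrow> crosses c \<rho> x \<alpha> (near c \<rho> x \<alpha> \<inter> Q)"
  by (simp add: crosses_def Int_ac)

lemma sym_link: "sym (link c \<rho> Q)"
  by (auto simp: link_def sym_def dist_commute add.commute)

lemma rtrancl_link_in:
  assumes "(a, b) \<in> (link c \<rho> Q)\<^sup>*" "a \<noteq> b" shows "a \<in> Q" "b \<in> Q"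
proof -
  have "a \<noteq> b \<longrightarrow> a \<in> Q \<and> b \<in> Q"
    using assms(1) by (induction rule: rtrancl_induct) (auto simp: link_def)
  then show "a \<in> Q" "b \<in> Q" using assms(2) by auto
qed

text \<open>
  Stop the chain when it first leaves the ball of radius \<open>2\<alpha>\<close>: every step made from inside that
  ball ends within distance \<open>3\<alpha>\<close>, so the stopped chain never leaves the region that
  \<^const>\<open>crosses\<close> may look at.
\<close>

lemma crosses_of_long_chain:
  assumes ab: "(a, b) \<in> (link c \<rho> Q)\<^sup>*"
    and a: "dist (c a) x \<le> \<alpha>" and b: "2 * \<alpha> \<le> dist (c b) x" and \<alpha>: "\<alpha> > 0"
    and small: "\<And>z. z \<in> Q \<Longrightarrow> dist (c z) x \<le> 3 * \<alpha> \<Longrightarrow> \<rho> z < \<alpha> / 2"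
    and step: "\<And>y z. (y, z) \<in> link c \<rho> Q \<Longrightarrow> dist (c y) x < 2 * \<alpha> \<Longrightarrow> dist (c z) x \<le> 3 * \<alpha>"
  shows "crosses c \<rho> x \<alpha> Q"
proof -
  let ?R = "link c \<rho> (Q \<inter> near c \<rho> x \<alpha>)"
  have "(dist (c b) x < 2 * \<alpha> \<and> (a, b) \<in> ?R\<^sup>*) \<or> (\<exists>z. 2 * \<alpha> \<le> dist (c z) x \<and> (a, z) \<in> ?R\<^sup>*)"
    using ab
  proof (induction rule: rtrancl_induct)
    case base
    then show ?case using a \<alpha> by auto
  next
    case (step y z)
    show ?case
    proof (cases "\<exists>z. 2 * \<alpha> \<le> dist (c z) x \<and> (a, z) \<in> ?R\<^sup>*")
      case False
      then have y: "dist (c y) x < 2 * \<alpha>" "(a, y) \<in> ?R\<^sup>*" using step.IH by auto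
      have "dist (c z) x \<le> 3 * \<alpha>" using assms(6)[OF step.hyps(2) y(1)] .
      moreover have "dist (c y) x \<le> 3 * \<alpha>" using y(1) \<alpha> by linarith
      ultimately have "(y, z) \<in> ?R" using step.hyps(2) small by (auto simp: link_def near_def)
      then have "(a, z) \<in> ?R\<^sup>*" using y(2) by (rule rtrancl_into_rtrancl[rotated])
      then show ?thesis by (meson not_le)
    qed auto
  qed
  then show ?thesis using a b unfolding crosses_def by (meson not_le)
qed

text \<open>
  The geometric core of the renormalisation. With radii below \<open>\<alpha>/2\<close>, the two ends of a crossing
  at scale \<open>10\<alpha>\<close> are at distance at least \<open>10\<alpha>\<close>. Each end lies within \<open>\<alpha>\<close> of a point of the
  rescaled net, and the chain, read forwards from one end and backwards from the other, runs far
  enough from both net points to cross at scale \<open>\<alpha>\<close>. The distance \<open>6\<close> is what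
  makes the two regions of radius \<open>3\<alpha>\<close> disjoint.
\<close>

lemma crosses_two_scales:
  fixes x :: "'b::real_normed_vector"
  assumes cr: "crosses c \<rho> x (10 * \<alpha>) Q" and \<alpha>: "\<alpha> > 0"
    and small: "\<And>z. z \<in> Q \<Longrightarrow> dist (c z) x \<le> 30 * \<alpha> \<Longrightarrow> \<rho> z < \<alpha> / 2"
    and K: "cball 0 30 \<subseteq> (\<Union>k\<in>K. ball k 1)"
  shows "\<exists>k\<in>K. \<exists>l\<in>K. 6 < dist k l \<and> crosses c \<rho> (x + \<alpha> *\<^sub>R k) \<alpha> Q \<and> crosses c \<rho> (x + \<alpha> *\<^sub>R l) \<alpha> Q"
proof -
  define Q' where "Q' = Q \<inter> near c \<rho> x (10 * \<alpha>)"
  obtain a b where a: "dist (c a) x \<le> 10 * \<alpha>" and b: "2 * (10 * \<alpha>) \<le> dist (c b) x"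
    and ab: "(a, b) \<in> (link c \<rho> Q')\<^sup>*"
    using cr unfolding crosses_def Q'_def by blast
  have "a \<noteq> b" using a b \<alpha> by auto
  note in_Q' = rtrancl_link_in[OF ab this]
  have Q': "dist (c z) x \<le> 30 * \<alpha>" "\<rho> z < \<alpha> / 2" if "z \<in> Q'" for z
    using that small unfolding Q'_def near_def by auto
  have net: "\<exists>k\<in>K. dist (c z) (x + \<alpha> *\<^sub>R k) < \<alpha>" if "z \<in> Q'" for z
  proof -
    define u where "u = (1 / \<alpha>) *\<^sub>R (c z - x)"
    have u: "\<alpha> *\<^sub>R u = c z - x" using \<alpha> by (simp add: u_def)
    have "norm u \<le> 30"
      using Q'(1)[OF that] \<alpha> unfolding u_def norm_scaleR dist_norm by (simp add: field_simps)
    then obtain k where k: "k \<in> K" "dist k u < 1" using K by (force simp: dist_norm)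
    have "dist (c z) (x + \<alpha> *\<^sub>R k) = norm (\<alpha> *\<^sub>R (u - k))"
      unfolding scaleR_diff_right u by (simp add: dist_norm algebra_simps)
    also have "\<dots> < \<alpha>" using k \<alpha> by (simp add: dist_norm norm_minus_commute)
    finally show ?thesis using k by blast
  qed
  have cross: "crosses c \<rho> y \<alpha> Q"
    if "(p, q) \<in> (link c \<rho> Q')\<^sup>*" "dist (c p) y < \<alpha>" "10 * \<alpha> \<le> dist (c p) (c q)" for p q y
  proof (rule crosses_mono[OF crosses_of_long_chain[OF that(1)]])
    show "2 * \<alpha> \<le> dist (c q) y"
      using that(2,3) \<alpha> dist_triangle[of "c p" "c q" y] by (simp add: dist_commute)
    show "dist (c z) y \<le> 3 * \<alpha>" if "(w, z) \<in> link c \<rho> Q'" "dist (c w) y < 2 * \<alpha>" for w z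
    proof -
      have "dist (c w) (c z) < \<alpha>" using that(1) Q'(2)[of w] Q'(2)[of z] by (auto simp: link_def)
      then show ?thesis using that(2) dist_triangle[of "c z" y "c w"] by (simp add: dist_commute)
    qed
  qed (use that \<alpha> Q' in \<open>auto simp: Q'_def\<close>)
  have far: "10 * \<alpha> \<le> dist (c a) (c b)"
    using a b dist_triangle[of "c b" x "c a"] by (simp add: dist_commute)
  obtain k l where k: "k \<in> K" "dist (c a) (x + \<alpha> *\<^sub>R k) < \<alpha>"
    and l: "l \<in> K" "dist (c b) (x + \<alpha> *\<^sub>R l) < \<alpha>"
    using net in_Q' by meson
  have ba: "(b, a) \<in> (link c \<rho> Q')\<^sup>*" using ab sym_rtrancl[OF sym_link] by (metis symD)
  have "dist (x + \<alpha> *\<^sub>R k) (x + \<alpha> *\<^sub>R l) = norm (\<alpha> *\<^sub>R (k - l))"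
    by (simp add: dist_norm algebra_simps)
  then have "dist (x + \<alpha> *\<^sub>R k) (x + \<alpha> *\<^sub>R l) = \<alpha> * dist k l" using \<alpha> by (simp add: dist_norm)
  moreover have "dist (x + \<alpha> *\<^sub>R k) (x + \<alpha> *\<^sub>R l) > 6 * \<alpha>"
    using far k(2) l(2) dist_triangle[of "c a" "c b" "x + \<alpha> *\<^sub>R k"]
      dist_triangle[of "x + \<alpha> *\<^sub>R k" "c b" "x + \<alpha> *\<^sub>R l"] \<alpha>
    by (simp add: dist_commute)
  ultimately have "6 < dist k l" using \<alpha> by (simp add: mult.commute)
  moreover have "crosses c \<rho> (x + \<alpha> *\<^sub>R k) \<alpha> Q" using cross[OF ab k(2) far] .
  moreover have "crosses c \<rho> (x + \<alpha> *\<^sub>R l) \<alpha> Q"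
    using cross[OF ba l(2)] far by (simp add: dist_commute)
  ultimately show ?thesis using k l by blast
qed

lemma near_disjoint:
  fixes x :: "'b::real_normed_vector"
  assumes "6 < dist k l" "\<alpha> > 0"
  shows "near c \<rho> (x + \<alpha> *\<^sub>R k) \<alpha> \<inter> near c \<rho> (x + \<alpha> *\<^sub>R l) \<alpha> = {}"
proof -
  have "dist (x + \<alpha> *\<^sub>R k) (x + \<alpha> *\<^sub>R l) = norm (\<alpha> *\<^sub>R (k - l))"
    by (simp add: dist_norm algebra_simps)
  also have "\<dots> = \<alpha> * dist k l" using assms by (simp add: dist_norm)
  also have "\<dots> > \<alpha> * 6" using assms by simp
  finally have far: "6 * \<alpha> < dist (x + \<alpha> *\<^sub>R k) (x + \<alpha> *\<^sub>R l)" by simp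
  show ?thesis
  proof (rule equals0I)
    fix z assume "z \<in> near c \<rho> (x + \<alpha> *\<^sub>R k) \<alpha> \<inter> near c \<rho> (x + \<alpha> *\<^sub>R l) \<alpha>"
    then show False
      using far dist_triangle2[of "x + \<alpha> *\<^sub>R k" "x + \<alpha> *\<^sub>R l" "c z"]
      by (auto simp: near_def dist_commute)
  qed
qed

text \<open>
  The hypothesis forbids big balls near the origin and, farther out, balls with a radius of at least
  a tenth of their distance to the origin. Hence all balls that the chain meets before leaving the ball of radius \<open>2\<alpha>\<close>,
  the first one outside included, have radius below \<open>\<alpha>/2\<close>.
\<close>

lemma crosses_of_escape:
  fixes c :: "'i \<Rightarrow> 'b::real_normed_vector"
  assumes y: "y \<in> connected_component_set (\<Union>a\<in>Q. ball (c a) (\<rho> a)) 0" "norm y > 3 * \<alpha>"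
    and \<alpha>: "\<alpha> > 0"
    and small: "\<And>z. z \<in> Q \<Longrightarrow> \<rho> z < max (\<alpha> / 2) (norm (c z) / 10)"
  shows "crosses c \<rho> 0 \<alpha> Q"
proof -
  obtain a b where a: "a \<in> Q" "0 \<in> ball (c a) (\<rho> a)" and b: "b \<in> Q" "y \<in> ball (c b) (\<rho> b)"
    and ab: "(a, b) \<in> {(i, j). i \<in> Q \<and> j \<in> Q \<and> ball (c i) (\<rho> i) \<inter> ball (c j) (\<rho> j) \<noteq> {}}\<^sup>*"
    using connected_cover_chain[OF _ y(1)] by auto
  have "dist (c i) (c j) < \<rho> i + \<rho> j" if "ball (c i) (\<rho> i) \<inter> ball (c j) (\<rho> j) \<noteq> {}" for i j
  proof -
    obtain z where "dist (c i) z < \<rho> i" "dist (c j) z < \<rho> j" using \<open>_ \<noteq> {}\<close> by auto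
    then show ?thesis using dist_triangle2[of "c i" "c j" z] by linarith
  qed
  then have "{(i, j). i \<in> Q \<and> j \<in> Q \<and> ball (c i) (\<rho> i) \<inter> ball (c j) (\<rho> j) \<noteq> {}} \<subseteq> link c \<rho> Q"
    by (auto simp: link_def)
  from subsetD[OF rtrancl_mono[OF this] ab] have ab: "(a, b) \<in> (link c \<rho> Q)\<^sup>*" .
  show ?thesis
  proof (rule crosses_of_long_chain[OF ab])
    show "dist (c a) 0 \<le> \<alpha>"
      using a small[of a] \<alpha> by (auto simp: max_def split: if_splits)
    show "2 * \<alpha> \<le> dist (c b) 0"
    proof (rule ccontr)
      assume "\<not> 2 * \<alpha> \<le> dist (c b) 0"
      then have *: "norm (c b) < 2 * \<alpha>" by simp
      then have "\<rho> b < \<alpha> / 2" using small[OF b(1)] \<alpha> by (auto simp: max_def split: if_splits)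
      moreover have "norm y \<le> norm (c b) + norm (y - c b)" by norm
      ultimately show False using * b(2) y(2) \<alpha> by (auto simp: dist_norm norm_minus_commute)
    qed
    show "\<rho> z < \<alpha> / 2" if "z \<in> Q" "dist (c z) 0 \<le> 3 * \<alpha>" for z
      using small[OF that(1)] that(2) \<alpha> by (auto simp: max_def split: if_splits)
    show "dist (c z) 0 \<le> 3 * \<alpha>" if "(w, z) \<in> link c \<rho> Q" "dist (c w) 0 < 2 * \<alpha>" for w z
    proof -
      have *: "w \<in> Q" "z \<in> Q" "dist (c w) (c z) < \<rho> w + \<rho> z" using that(1) by (auto simp: link_def)
      have "\<rho> w < \<alpha> / 2" using small[OF *(1)] that(2) \<alpha> by (auto simp: max_def split: if_splits)
      moreover have "norm (c z) \<le> norm (c w) + dist (c w) (c z)"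
        unfolding dist_norm by norm
      ultimately show ?thesis using small[OF *(2)] that(2) *(3) \<alpha>
        by (auto simp: max_def split: if_splits)
    qed
  qed (rule \<alpha>)
qed

section \<open>The scale recursion in the reals\<close>

text \<open>
  Summing the recursion gives \<open>S \<le> x\<^sub>0 + S/2 + \<Sum>y\<close> for every partial sum \<open>S\<close> of \<open>x\<close>.
\<close>

lemma summable_of_halving:
  fixes x y :: "nat \<Rightarrow> real"
  assumes x: "\<And>n. 0 \<le> x n" and y: "\<And>n. 0 \<le> y n" "summable y"
    and rec: "\<And>n. x (Suc n) \<le> x n / 2 + y n"
  shows "summable x"
proof (rule summableI_nonneg_bounded)
  show "0 \<le> x n" for n by (rule x)
  show "(\<Sum>i<n. x i) \<le> 2 * (x 0 + suminf y)" for n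
  proof -
    have "(\<Sum>i<Suc n. x i) \<le> x 0 + (\<Sum>i<n. x i / 2 + y i)"
      unfolding sum.lessThan_Suc_shift using sum_mono[OF rec] by auto
    also have "\<dots> = x 0 + (\<Sum>i<n. x i) / 2 + (\<Sum>i<n. y i)"
      by (simp add: sum.distrib sum_divide_distrib)
    also have "(\<Sum>i<n. y i) \<le> suminf y"
      using y by (intro sum_le_suminf) auto
    finally have "(\<Sum>i<n. x i) / 2 \<le> x 0 + suminf y" using x[of n] by simp
    then show ?thesis by simp
  qed
qed

fun scale_bound :: "real \<Rightarrow> real \<Rightarrow> (nat \<Rightarrow> real) \<Rightarrow> nat \<Rightarrow> real" where
  "scale_bound C p e 0 = p"
| "scale_bound C p e (Suc n) = C * (scale_bound C p e n)\<^sup>2 + e n"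

text \<open>
  The smallness of \<open>p\<close> and \<open>e\<close> keeps \<open>C p\<^sub>n \<le> 1/2\<close>, so that at first the quadratic recursion
  is only as good as halving. This already gives \<open>p\<^sub>n \<longlonglongrightarrow> 0\<close>, and once \<open>C p\<^sub>n \<le> 1/(2q)\<close> the
  weighted sequence \<open>q\<^sup>n p\<^sub>n\<close> is halved as well. The rate \<open>q\<close> does not enter the
  smallness conditions; this is why the bound on the intensity can be chosen independently of \<open>s\<close>.
\<close>

lemma scale_bound_summable:
  assumes C: "C > 0" and p: "0 \<le> p" "C * p \<le> 1/2"
    and e: "\<And>n. 0 \<le> e n" "\<And>n. C * e n \<le> 1/4"
    and q: "q \<ge> 1" and sum: "summable (\<lambda>n. q ^ n * e n)"
  shows "summable (\<lambda>n. q ^ n * scale_bound C p e n)"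
proof -
  let ?p = "scale_bound C p e"
  have nn: "0 \<le> ?p n" for n using p e C by (cases n) auto
  have half: "C * ?p n \<le> 1/2" for n
  proof (induction n)
    case (Suc n)
    have "C * ?p (Suc n) = (C * ?p n)\<^sup>2 + C * e n" by (simp add: power2_eq_square algebra_simps)
    also have "(C * ?p n)\<^sup>2 \<le> (1/2)\<^sup>2" using Suc nn C by (intro power_mono) auto
    finally show ?case using e(2)[of n] by (simp add: power2_eq_square)
  qed (use p in simp)
  have se: "summable e"
  proof (rule summable_comparison_test'[OF sum])
    show "norm (e n) \<le> q ^ n * e n" for n
      using e(1)[of n] one_le_power[OF q, of n] mult_right_mono[of 1 "q ^ n" "e n"] by simp
  qed
  have rec: "?p (Suc n) = (C * ?p n) * ?p n + e n" for n by (simp add: power2_eq_square)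
  have "summable ?p"
  proof (rule summable_of_halving[OF nn e(1) se])
    show "?p (Suc n) \<le> ?p n / 2 + e n" for n
      using mult_right_mono[OF half nn, of n n] unfolding rec by simp
  qed
  then have "?p \<longlonglongrightarrow> 0" by (rule summable_LIMSEQ_zero)
  then have "\<forall>\<^sub>F n in sequentially. ?p n < 1 / (2 * C * q)"
    using C q by (intro order_tendstoD(2)) auto
  then obtain N where N: "\<And>n. n \<ge> N \<Longrightarrow> ?p n < 1 / (2 * C * q)"
    unfolding eventually_sequentially by blast
  have "summable (\<lambda>n. q ^ (n + N) * ?p (n + N))"
  proof (rule summable_of_halving)
    show "summable (\<lambda>n. q * (q ^ (n + N) * e (n + N)))"
      using sum summable_iff_shift[of "\<lambda>n. q ^ n * e n" N] by (intro summable_mult) auto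
    fix n
    show "0 \<le> q ^ (n + N) * ?p (n + N)" "0 \<le> q * (q ^ (n + N) * e (n + N))"
      using q nn e by auto
    have "q * (C * ?p (n + N)) \<le> 1/2"
      using N[of "n + N"] C q by (simp add: field_simps)
    from mult_right_mono[OF this, of "q ^ (n + N) * ?p (n + N)"]
    have "q * (C * ?p (n + N)) * (q ^ (n + N) * ?p (n + N)) \<le> q ^ (n + N) * ?p (n + N) / 2"
      using q nn by simp
    then show "q ^ (Suc n + N) * ?p (Suc n + N)
      \<le> q ^ (n + N) * ?p (n + N) / 2 + q * (q ^ (n + N) * e (n + N))"
      unfolding add_Suc rec power_Suc by (simp only: algebra_simps)
  qed
  then show ?thesis using summable_iff_shift[of "\<lambda>n. q ^ n * ?p n" N] by simp
qed

text \<open>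
  A geometric sum is at most a constant times its last term, and the last \<open>n\<close> with
  \<open>b\<^sup>n \<le> t\<close> contributes at most \<open>t\<^sup>s\<close>.
\<close>

lemma geometric_layers_le:
  fixes q b t s :: real
  assumes b: "b > 1" and s: "s > 0" and t: "t > 0"
  defines "q \<equiv> b powr s"
  shows "(\<Sum>n<N. if b ^ n \<le> t then q ^ n else 0) \<le> q / (q - 1) * t powr s"
proof (induction N)
  have q: "q > 1" unfolding q_def using b s powr_less_mono[of 0 s b] by simp
  case 0
  then show ?case using q by simp
next
  have q: "q > 1" unfolding q_def using b s powr_less_mono[of 0 s b] by simp
  case (Suc N)
  show ?case
  proof (cases "b ^ N \<le> t")
    case True
    have "(\<Sum>n<Suc N. if b ^ n \<le> t then q ^ n else 0) \<le> (\<Sum>n<Suc N. q ^ n)"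
      using q by (intro sum_mono) auto
    also have "\<dots> = (q ^ Suc N - 1) / (q - 1)"
      using q geometric_sum[of q "Suc N"] by simp
    also have "\<dots> \<le> q / (q - 1) * q ^ N" using q by (simp add: field_simps)
    also have "q ^ N = (b ^ N) powr s"
      using b unfolding q_def by (simp add: powr_powr powr_realpow[symmetric] mult.commute)
    also have "q / (q - 1) * (b ^ N) powr s \<le> q / (q - 1) * t powr s"
      using True q s b by (intro mult_left_mono powr_mono2) auto
    finally show ?thesis .
  qed (use Suc in simp)
qed

section \<open>The intensity measure\<close>

lemma space_radius_law: "radius_law \<nu> \<Longrightarrow> space \<nu> = {0<..}"
  by (auto simp: radius_law_def dest: sets_eq_imp_space_eq)

lemma measurable_radius_law:
  assumes "radius_law \<nu>" "f \<in> borel_measurable borel" shows "f \<in> borel_measurable \<nu>"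
proof -
  have "sets \<nu> = sets (restrict_space borel {0<..})" using assms(1) by (simp add: radius_law_def)
  then show ?thesis using measurable_restrict_space1[OF assms(2)] measurable_cong_sets by blast
qed

lemma space_intensity:
  "radius_law \<nu> \<Longrightarrow> space (intensity lam \<nu> :: ((real ^ 'd) \<times> real) measure) = UNIV \<times> {0<..}"
  by (simp add: intensity_def space_pair_measure space_scale_measure space_radius_law)

lemma sets_intensity:
  assumes "radius_law \<nu>" "A \<in> sets borel"
  shows "A \<inter> (UNIV \<times> {0<..}) \<in> sets (intensity lam \<nu> :: ((real ^ 'd) \<times> real) measure)"
proof -
  have "(\<lambda>r. r) \<in> borel_measurable \<nu>" by (rule measurable_radius_law[OF assms(1)]) auto
  then have sm: "snd \<in> borel_measurable (scale_measure (ennreal lam) lborel \<Otimes>\<^sub>M \<nu>)"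
    using measurable_compose[OF measurable_snd] by fastforce
  have "fst \<in> (scale_measure (ennreal lam) lborel \<Otimes>\<^sub>M \<nu>) \<rightarrow>\<^sub>M (borel :: (real ^ 'd) measure)"
    by (rule measurable_fst'') (auto intro: measurableI simp: space_scale_measure)
  from this sm have "(\<lambda>p. (fst p, snd p)) \<in> intensity lam \<nu> \<rightarrow>\<^sub>M (borel :: ((real ^ 'd) \<times> real) measure)"
    unfolding intensity_def by (rule borel_measurable_Pair)
  from measurable_sets[OF this assms(2)] show ?thesis
    by (simp add: space_intensity[OF assms(1)])
qed

text \<open>
  The regions of the form ``centre within a radius-dependent distance of \<open>x\<close>''; by Fubini
  their intensity is an integral over \<open>\<nu>\<close> of volumes of balls.
\<close>

definition shadow :: "real ^ 'd \<Rightarrow> (real \<Rightarrow> real) \<Rightarrow> ((real ^ 'd) \<times> real) set" where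
  "shadow x h = {(c, r). dist c x < h r} \<inter> (UNIV \<times> {0<..})"

lemma sets_shadow:
  assumes "radius_law \<nu>" and [measurable]: "h \<in> borel_measurable borel"
  shows "shadow x h \<in> sets (intensity lam \<nu> :: ((real ^ 'd::finite) \<times> real) measure)"
proof -
  have [measurable]: "fst \<in> (borel :: ((real ^ 'd) \<times> real) measure) \<rightarrow>\<^sub>M borel"
    "snd \<in> (borel :: ((real ^ 'd) \<times> real) measure) \<rightarrow>\<^sub>M borel"
    by (intro borel_measurable_continuous_onI continuous_on_fst continuous_on_snd continuous_on_id)+
  have "{p \<in> space borel. dist (fst (p :: (real ^ 'd) \<times> real)) x < h (snd p)} \<in> sets borel"
    by measurable
  then show ?thesis
    unfolding shadow_def by (intro sets_intensity[OF assms(1)]) (simp add: case_prod_beta)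
qed

lemma emeasure_shadow:
  assumes \<nu>: "radius_law \<nu>" and lam: "0 < lam"
    and h: "h \<in> borel_measurable borel" "\<And>r. 0 < r \<Longrightarrow> 0 \<le> h r"
  shows "emeasure (intensity lam \<nu>) (shadow (x :: real ^ 'd::finite) h)
       = ennreal (lam * unit_ball_vol CARD('d)) * (\<integral>\<^sup>+ r. ennreal (h r ^ CARD('d)) \<partial>\<nu>)"
proof -
  have dens: "scale_measure (ennreal lam) lborel = density (lborel :: (real ^ 'd) measure) (\<lambda>_. ennreal lam)"
    by (rule measure_eqI) (simp_all add: emeasure_density nn_integral_cmult)
  have sf: "sigma_finite_measure (scale_measure (ennreal lam) (lborel :: (real ^ 'd) measure))"
    unfolding dens by (subst sigma_finite_measure.sigma_finite_iff_density_finite[OF sigma_finite_lborel]) auto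
  interpret N: prob_space \<nu> using \<nu> by (simp add: radius_law_def)
  interpret pair_sigma_finite "scale_measure (ennreal lam) (lborel :: (real ^ 'd) measure)" \<nu>
    unfolding pair_sigma_finite_def using sf N.sigma_finite_measure_axioms by blast
  have hm: "(\<lambda>r. ennreal (h r ^ CARD('d))) \<in> borel_measurable \<nu>"
    using h(1) by (intro measurable_radius_law[OF \<nu>]) measurable
  have "emeasure (intensity lam \<nu>) (shadow x h) =
      (\<integral>\<^sup>+ r. emeasure (scale_measure (ennreal lam) lborel) ((\<lambda>c. (c, r)) -` shadow x h) \<partial>\<nu>)"
    using sets_shadow[OF \<nu> h(1), of x lam] unfolding intensity_def
    by (rule emeasure_pair_measure_alt2)
  also have "\<dots> = (\<integral>\<^sup>+ r. ennreal (lam * unit_ball_vol CARD('d)) * ennreal (h r ^ CARD('d)) \<partial>\<nu>)"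
  proof (rule nn_integral_cong)
    fix r assume "r \<in> space \<nu>"
    then have r: "0 < r" using space_radius_law[OF \<nu>] by auto
    have "(\<lambda>c. (c, r)) -` shadow x h = ball x (h r)"
      using r by (auto simp: shadow_def dist_commute)
    then show "emeasure (scale_measure (ennreal lam) lborel) ((\<lambda>c. (c, r)) -` shadow x h)
        = ennreal (lam * unit_ball_vol CARD('d)) * ennreal (h r ^ CARD('d))"
      using h(2)[OF r] lam
      by (simp only: emeasure_scale_measure emeasure_ball ennreal_mult' mult.assoc less_imp_le
          unit_ball_vol_nonneg DIM_cart DIM_real mult_1_right)
  qed
  also have "\<dots> = ennreal (lam * unit_ball_vol CARD('d)) * (\<integral>\<^sup>+ r. ennreal (h r ^ CARD('d)) \<partial>\<nu>)"
    by (rule nn_integral_cmult[OF hm])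
  finally show ?thesis .
qed

section \<open>Poisson counts\<close>

lemma num_points_eq_0: "num_points X A = 0 \<longleftrightarrow> X \<inter> A = {}"
  unfolding num_points_def by (subst emeasure_count_space_eq_0) auto

locale boolean_percolation =
  fixes P :: "((real ^ 'd::finite) \<times> real) set measure" and lam :: real and \<nu> :: "real measure"
  assumes \<nu>: "radius_law \<nu>" and lam: "0 < lam" and model: "boolean_model P lam \<nu>"
begin

abbreviation "\<mu> \<equiv> (intensity lam \<nu> :: ((real ^ 'd) \<times> real) measure)"

sublocale prob_space P
  using model by (simp add: boolean_model_def poisson_process_def)

lemma positive_radius: "\<omega> \<in> space P \<Longrightarrow> (c, r) \<in> \<omega> \<Longrightarrow> 0 < r"
  using model space_intensity[OF \<nu>, of lam] unfolding boolean_model_def poisson_process_def by blast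

lemma measurable_num_points: "A \<in> sets \<mu> \<Longrightarrow> (\<lambda>\<omega>. num_points \<omega> A) \<in> borel_measurable P"
  using model by (simp add: boolean_model_def poisson_process_def)

lemma prob_num_points:
  assumes "A \<in> sets \<mu>" "emeasure \<mu> A < \<infinity>"
  shows "prob {\<omega> \<in> space P. num_points \<omega> A = of_nat k} = measure \<mu> A ^ k / fact k * exp (- measure \<mu> A)"
  using model assms by (simp add: boolean_model_def poisson_process_def)

lemma AE_num_points_infinite:
  assumes "A \<in> sets \<mu>" "emeasure \<mu> A = \<infinity>" shows "AE \<omega> in P. num_points \<omega> A = \<infinity>"
  using model assms by (simp add: boolean_model_def poisson_process_def)

text \<open>
  Independence of an infinite family is a statement about its finite subfamilies, and each of these
  is contained in an initial segment of the sequence.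
\<close>

lemma indep_num_points:
  assumes "\<And>i::nat. A i \<in> sets \<mu>" "disjoint_family A"
  shows "indep_vars (\<lambda>_. borel) (\<lambda>i \<omega>. num_points \<omega> (A i)) UNIV"
proof -
  have fin: "indep_vars (\<lambda>_. borel) (\<lambda>i \<omega>. num_points \<omega> (A i)) {..<n}" for n
    using model assms unfolding boolean_model_def poisson_process_def
    by (meson disjoint_family_on_mono subset_UNIV)
  show ?thesis
    unfolding indep_vars_def2
  proof (intro conjI ballI)
    show "random_variable borel (\<lambda>\<omega>. num_points \<omega> (A i))" for i
      using assms by (intro measurable_num_points)
    let ?F = "\<lambda>i. {(\<lambda>\<omega>. num_points \<omega> (A i)) -` B \<inter> space P |B. B \<in> sets borel}"
    show "indep_sets ?F UNIV"
    proof (subst indep_sets_finite_index_sets, intro allI impI)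
      fix J :: "nat set" assume "finite J"
      then obtain n where "J \<subseteq> {..<n}" using finite_nat_iff_bounded by blast
      with fin[of n] have "indep_vars (\<lambda>_. borel) (\<lambda>i \<omega>. num_points \<omega> (A i)) J"
        by (rule indep_vars_subset)
      then show "indep_sets ?F J"
        unfolding indep_vars_def2 by auto
    qed
  qed
qed

lemma prob_hit_le:
  assumes A: "A \<in> sets \<mu>" "emeasure \<mu> A < \<infinity>"
  shows "{\<omega> \<in> space P. \<omega> \<inter> A \<noteq> {}} \<in> events" "prob {\<omega> \<in> space P. \<omega> \<inter> A \<noteq> {}} \<le> measure \<mu> A"
proof -
  have [measurable]: "(\<lambda>\<omega>. num_points \<omega> A) \<in> borel_measurable P"
    using A by (intro measurable_num_points)
  have eq: "{\<omega> \<in> space P. \<omega> \<inter> A \<noteq> {}} = space P - {\<omega> \<in> space P. num_points \<omega> A = 0}"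
    by (auto simp: num_points_eq_0)
  show "{\<omega> \<in> space P. \<omega> \<inter> A \<noteq> {}} \<in> events" unfolding eq by measurable
  have "prob {\<omega> \<in> space P. \<omega> \<inter> A \<noteq> {}} = 1 - exp (- measure \<mu> A)"
    unfolding eq using prob_num_points[OF A, of 0] by (subst prob_compl) auto
  also have "\<dots> \<le> measure \<mu> A" using exp_ge_add_one_self[of "- measure \<mu> A"] by simp
  finally show "prob {\<omega> \<in> space P. \<omega> \<inter> A \<noteq> {}} \<le> measure \<mu> A" .
qed

end

section \<open>Discretised crossings\<close>

lemma pred_rtrancl:
  fixes R :: "'w \<Rightarrow> ('i::countable \<times> 'i) set"
  assumes R: "\<And>a b. Measurable.pred M (\<lambda>\<omega>. (a, b) \<in> R \<omega>)"
  shows "Measurable.pred M (\<lambda>\<omega>. (a, b) \<in> (R \<omega>)\<^sup>*)"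
proof -
  have [measurable]: "Measurable.pred M (\<lambda>\<omega>. (a, b) \<in> (R \<omega>) ^^ n)" for n b
  proof (induction n arbitrary: b)
    case (Suc n)
    have [measurable]: "Measurable.pred M (\<lambda>\<omega>. (a, c) \<in> (R \<omega>) ^^ n)"
      "Measurable.pred M (\<lambda>\<omega>. (c, b) \<in> R \<omega>)" for c by (rule Suc, rule R)
    have "(\<lambda>\<omega>. (a, b) \<in> (R \<omega>) ^^ Suc n) = (\<lambda>\<omega>. \<exists>c. (a, c) \<in> (R \<omega>) ^^ n \<and> (c, b) \<in> R \<omega>)"
      by (auto simp: relcomp_unfold)
    then show ?case by simp
  qed simp
  show ?thesis unfolding rtrancl_power by measurable
qed

text \<open>
  A crossing is a countable union, over the endpoints and the length of the chain, of events about
  the occupation of single indices.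
\<close>

lemma pred_crosses:
  fixes S :: "'w \<Rightarrow> 'i::countable set"
  assumes S [measurable]: "\<And>n. Measurable.pred M (\<lambda>\<omega>. n \<in> S \<omega>)"
  shows "Measurable.pred M (\<lambda>\<omega>. crosses c \<rho> x \<alpha> (S \<omega>))"
proof -
  have [measurable]: "Measurable.pred M (\<lambda>\<omega>. (a, b) \<in> (link c \<rho> (S \<omega> \<inter> near c \<rho> x \<alpha>))\<^sup>*)" for a b
    by (rule pred_rtrancl) (simp add: link_def)
  show ?thesis unfolding crosses_def by measurable
qed

lemma ex_countable_net:
  assumes "\<eta> > 0"
  shows "\<exists>D :: nat \<Rightarrow> 'b::{metric_space, second_countable_topology}. (\<Union>n. ball (D n) \<eta>) = UNIV"
proof -
  obtain E :: "'b set" where E: "countable E" "\<And>X. open X \<Longrightarrow> X \<noteq> {} \<Longrightarrow> \<exists>d\<in>E. d \<in> X"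
    using countable_dense_exists by blast
  then have "E \<noteq> {}" by blast
  have "p \<in> (\<Union>n. ball (from_nat_into E n) \<eta>)" for p
  proof -
    obtain e where e: "e \<in> E" "e \<in> ball p \<eta>"
      using E(2)[of "ball p \<eta>"] assms by auto
    then obtain n where "from_nat_into E n = e"
      using E(1) \<open>E \<noteq> {}\<close> from_nat_into_surj by metis
    then show ?thesis using e by (auto simp: dist_commute)
  qed
  then show ?thesis by blast
qed

locale discretised = boolean_percolation P lam \<nu>
  for P :: "((real ^ 'd::finite) \<times> real) set measure" and lam \<nu> +
  fixes D :: "nat \<Rightarrow> (real ^ 'd) \<times> real" and \<eta> :: real
  assumes \<eta>: "0 < \<eta>" and net: "(\<Union>n. ball (D n) \<eta>) = UNIV"
begin

definition cell :: "nat \<Rightarrow> ((real ^ 'd) \<times> real) set" where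
  "cell n = disjointed (\<lambda>n. ball (D n) \<eta>) n \<inter> (UNIV \<times> {0<..})"

definition centre :: "nat \<Rightarrow> real ^ 'd" where
  "centre n = fst (D n)"

text \<open>
  One \<open>\<eta>\<close> pays for the displacement of the centre and one for the change of the radius, so that the
  ball of a cell contains the balls of all its points.
\<close>

definition rad :: "nat \<Rightarrow> real" where
  "rad n = snd (D n) + 2 * \<eta>"

definition occ :: "((real ^ 'd) \<times> real) set \<Rightarrow> nat set" where
  "occ \<omega> = {n. \<omega> \<inter> cell n \<noteq> {}}"

lemma in_cell:
  assumes "(c, r) \<in> cell n"
  shows "dist c (centre n) < \<eta>" "r + \<eta> < rad n" "rad n < r + 3 * \<eta>" "0 < r"
proof -
  have "dist (D n) (c, r) < \<eta>" "0 < r"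
    using assms disjointed_subset[of "\<lambda>n. ball (D n) \<eta>" n] by (auto simp: cell_def)
  moreover have "dist (fst (D n)) c \<le> dist (D n) (c, r)" "dist (snd (D n)) r \<le> dist (D n) (c, r)"
    using dist_fst_le[of "D n" "(c, r)"] dist_snd_le[of "D n" "(c, r)"] by auto
  ultimately show "dist c (centre n) < \<eta>" "r + \<eta> < rad n" "rad n < r + 3 * \<eta>" "0 < r"
    by (auto simp: centre_def rad_def dist_commute dist_real_def)
qed

lemma ex_cell:
  assumes "\<omega> \<in> space P" "p \<in> \<omega>" shows "\<exists>n\<in>occ \<omega>. p \<in> cell n"
proof -
  have "p \<in> (\<Union>n. disjointed (\<lambda>n. ball (D n) \<eta>) n)"
    unfolding UN_disjointed_eq net by simp
  then obtain n where "p \<in> disjointed (\<lambda>n. ball (D n) \<eta>) n" by blast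
  then have "p \<in> \<omega> \<inter> cell n"
    using assms positive_radius[of \<omega> "fst p" "snd p"] by (simp add: cell_def mem_Times_iff)
  then show ?thesis by (auto simp: occ_def)
qed

lemma sets_cell: "cell n \<in> sets \<mu>"
proof -
  have "range (disjointed (\<lambda>n. ball (D n) \<eta>)) \<subseteq> sets borel"
    by (rule sets.range_disjointed_sets) auto
  then show ?thesis unfolding cell_def by (intro sets_intensity[OF \<nu>]) blast
qed

lemma disjoint_cell: "disjoint_family cell"
  using disjoint_family_disjointed[of "\<lambda>n. ball (D n) \<eta>"]
  unfolding disjoint_family_on_def cell_def by blast

lemma occ_iff: "n \<in> occ \<omega> \<longleftrightarrow> num_points \<omega> (cell n) \<noteq> 0"
  by (simp add: occ_def num_points_eq_0)

lemma cluster_subset: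
  assumes "\<omega> \<in> space P"
  shows "cluster \<omega> \<subseteq> connected_component_set (\<Union>n\<in>occ \<omega>. ball (centre n) (rad n)) 0"
proof -
  have "occupied \<omega> \<subseteq> (\<Union>n\<in>occ \<omega>. ball (centre n) (rad n))"
  proof
    fix y assume "y \<in> occupied \<omega>"
    then obtain c r where cr: "(c, r) \<in> \<omega>" "dist c y < r" by (auto simp: occupied_def)
    obtain n where n: "n \<in> occ \<omega>" "(c, r) \<in> cell n" using ex_cell[OF assms cr(1)] by blast
    have "dist (centre n) y < rad n"
      using in_cell[OF n(2)] cr(2) dist_triangle3[of "centre n" y c] by linarith
    then show "y \<in> (\<Union>n\<in>occ \<omega>. ball (centre n) (rad n))" using n by auto
  qed
  then show ?thesis unfolding cluster_def by (rule connected_component_mono)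
qed

definition crossing :: "real ^ 'd \<Rightarrow> real \<Rightarrow> ((real ^ 'd) \<times> real) set set" where
  "crossing x \<alpha> = {\<omega> \<in> space P. crosses centre rad x \<alpha> (occ \<omega>)}"

text \<open>
  The factor \<open>125\<close> is large enough for both uses: in \<open>prob_crossing_rec\<close> the centres are within
  \<open>30\<alpha> + \<eta>\<close> of \<open>x\<close>, which is less than \<open>125 \<cdot> \<alpha>/4\<close>, and in \<open>cluster_diameter_le\<close> they are within
  a fixed multiple of their own radius from \<open>0\<close>. Relating the distance to \<open>r\<close> and not to \<open>\<alpha>\<close> gives
  the volume \<open>r\<^sup>d\<close>, and thus exactly the moment of order \<open>d\<close>.
\<close>

definition giants :: "real ^ 'd \<Rightarrow> real \<Rightarrow> ((real ^ 'd) \<times> real) set" where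
  "giants x \<alpha> = shadow x (\<lambda>r. if \<alpha> / 4 \<le> r then 125 * r else 0)"

lemma in_giants: "(c, r) \<in> giants x \<alpha> \<longleftrightarrow> 0 < r \<and> \<alpha> / 4 \<le> r \<and> dist c x < 125 * r"
  by (auto simp: giants_def shadow_def split: if_splits)

lemma sets_giants: "giants x \<alpha> \<in> sets \<mu>"
  unfolding giants_def by (intro sets_shadow[OF \<nu>]) measurable

lemma measurable_cell_count [measurable]: "(\<lambda>\<omega>. num_points \<omega> (cell n)) \<in> borel_measurable P"
  by (rule measurable_num_points[OF sets_cell])

lemma crossing_in_events: "crossing x \<alpha> \<in> events"
proof -
  have "Measurable.pred P (\<lambda>\<omega>. crosses centre rad x \<alpha> (occ \<omega>))"
    by (rule pred_crosses) (simp add: occ_iff)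
  then show ?thesis unfolding crossing_def by measurable
qed

text \<open>
  Both events are functions of the counts in two disjoint families of cells.
\<close>

lemma prob_crossing_Int:
  assumes "near centre rad x \<alpha> \<inter> near centre rad y \<beta> = {}"
  shows "prob (crossing x \<alpha> \<inter> crossing y \<beta>) = prob (crossing x \<alpha>) * prob (crossing y \<beta>)"
proof -
  let ?N = "\<lambda>i \<omega>. num_points \<omega> (cell i)"
  \<comment> \<open>A crossing is the preimage of a fixed set \<open>H\<close> of count vectors under the counts in the cells near \<open>x\<close>.\<close>
  define R where "R x \<alpha> \<omega> = restrict (\<lambda>i. ?N i \<omega>) (near centre rad x \<alpha>)" for x \<alpha> \<omega>
  define M where "M x \<alpha> = PiM (near centre rad x \<alpha>) (\<lambda>_. borel :: ennreal measure)" for x \<alpha>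
  define H where "H x \<alpha> = {f \<in> space (M x \<alpha>). crosses centre rad x \<alpha> {n \<in> near centre rad x \<alpha>. f n \<noteq> 0}}"
    for x \<alpha>
  have ind: "indep_var (M x \<alpha>) (R x \<alpha>) (M y \<beta>) (R y \<beta>)"
    unfolding M_def R_def
    by (rule indep_var_restrict[OF indep_num_points[OF sets_cell disjoint_cell] assms]) auto
  have H: "H x \<alpha> \<in> sets (M x \<alpha>)" for x \<alpha>
  proof -
    have "Measurable.pred (M x \<alpha>) (\<lambda>f. n \<in> {n \<in> near centre rad x \<alpha>. f n \<noteq> 0})" for n
    proof (cases "n \<in> near centre rad x \<alpha>")
      case True
      then have [measurable]: "(\<lambda>f. f n) \<in> borel_measurable (M x \<alpha>)"
        unfolding M_def by (rule measurable_component_singleton)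
      show ?thesis using True by simp
    qed simp
    then have "Measurable.pred (M x \<alpha>) (\<lambda>f. crosses centre rad x \<alpha> {n \<in> near centre rad x \<alpha>. f n \<noteq> 0})"
      by (rule pred_crosses)
    then show ?thesis unfolding H_def by measurable
  qed
  have G: "crossing x \<alpha> = R x \<alpha> -` H x \<alpha> \<inter> space P" for x \<alpha>
  proof -
    have "{n \<in> near centre rad x \<alpha>. R x \<alpha> \<omega> n \<noteq> 0} = near centre rad x \<alpha> \<inter> occ \<omega>" for \<omega>
      by (auto simp: R_def occ_iff)
    moreover have "R x \<alpha> \<omega> \<in> space (M x \<alpha>)" for \<omega>
      by (auto simp: R_def M_def space_PiM)
    ultimately show ?thesis
      by (auto simp: crossing_def H_def crosses_Int[of _ _ _ _ "occ _"])
  qed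
  have "(\<lambda>\<omega>. (R x \<alpha> \<omega>, R y \<beta> \<omega>)) -` (H x \<alpha> \<times> H y \<beta>) \<inter> space P = crossing x \<alpha> \<inter> crossing y \<beta>"
    unfolding G by auto
  then show ?thesis using indep_varD[OF ind H H] unfolding G by simp
qed

text \<open>
  The bound \<open>p\<close> is uniform in \<open>x\<close>, which replaces the stationarity of the process: after
  discretisation the model is not invariant under translations.
\<close>

lemma prob_crossing_rec:
  fixes K :: "(real ^ 'd) set" and p :: real
  assumes K: "finite K" "cball 0 30 \<subseteq> (\<Union>k\<in>K. ball k 1)"
    and \<alpha>: "12 * \<eta> \<le> \<alpha>" and p: "\<And>x. prob (crossing x \<alpha>) \<le> p"
    and fin: "emeasure \<mu> (giants x \<alpha>) < \<infinity>"
  shows "prob (crossing x (10 * \<alpha>)) \<le> (card K)\<^sup>2 * p\<^sup>2 + measure \<mu> (giants x \<alpha>)"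
proof -
  have \<alpha>0: "0 < \<alpha>" using \<alpha> \<eta> by linarith
  have p0: "0 \<le> p" using p[of 0] measure_nonneg order_trans by blast
  let ?KK = "{kl \<in> K \<times> K. 6 < dist (fst kl) (snd kl)}"
  let ?T = "{\<omega> \<in> space P. \<omega> \<inter> giants x \<alpha> \<noteq> {}}"
  let ?J = "\<lambda>kl. crossing (x + \<alpha> *\<^sub>R fst kl) \<alpha> \<inter> crossing (x + \<alpha> *\<^sub>R snd kl) \<alpha>"
  have sub: "crossing x (10 * \<alpha>) \<subseteq> (\<Union>kl\<in>?KK. ?J kl) \<union> ?T"
  proof
    fix \<omega> assume \<omega>: "\<omega> \<in> crossing x (10 * \<alpha>)"
    show "\<omega> \<in> (\<Union>kl\<in>?KK. ?J kl) \<union> ?T"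
    proof (cases "\<omega> \<inter> giants x \<alpha> = {}")
      case True
      have "rad z < \<alpha> / 2" if z: "z \<in> occ \<omega>" "dist (centre z) x \<le> 30 * \<alpha>" for z
      proof (rule ccontr)
        assume *: "\<not> rad z < \<alpha> / 2"
        obtain c r where cr: "(c, r) \<in> \<omega>" "(c, r) \<in> cell z"
          using z(1) by (auto simp: occ_def)
        note c = in_cell[OF cr(2)]
        have "dist c x < 125 * r"
          using c * \<alpha> z(2) dist_triangle[of c x "centre z"] by linarith
        then have "(c, r) \<in> giants x \<alpha>" using c * \<alpha> by (simp add: in_giants)
        then show False using True cr by auto
      qed
      from crosses_two_scales[where c = centre and \<rho> = rad and Q = "occ \<omega>" and x = x, OF _ \<alpha>0 this K(2)]
      obtain k l where "k \<in> K" "l \<in> K" "6 < dist k l" "\<omega> \<in> ?J (k, l)"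
        using \<omega> by (auto simp: crossing_def)
      then show ?thesis by force
    qed (use \<omega> in \<open>auto simp: crossing_def\<close>)
  qed
  have fKK: "finite ?KK" using K(1) by simp
  have "prob (crossing x (10 * \<alpha>)) \<le> prob ((\<Union>kl\<in>?KK. ?J kl) \<union> ?T)"
    using fKK prob_hit_le(1)[OF sets_giants fin]
    by (intro finite_measure_mono[OF sub] sets.Un sets.finite_UN) (auto intro!: crossing_in_events)
  also have "\<dots> \<le> prob (\<Union>kl\<in>?KK. ?J kl) + prob ?T"
    using fKK prob_hit_le(1)[OF sets_giants fin]
    by (intro measure_Un_le sets.finite_UN) (auto intro!: crossing_in_events)
  also have "prob ?T \<le> measure \<mu> (giants x \<alpha>)"
    by (rule prob_hit_le(2)[OF sets_giants fin])
  also have "prob (\<Union>kl\<in>?KK. ?J kl) \<le> (\<Sum>kl\<in>?KK. prob (?J kl))"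
    using fKK by (intro measure_UNION_le) (auto intro!: crossing_in_events)
  also have "\<dots> \<le> (\<Sum>kl\<in>?KK. p\<^sup>2)"
  proof (rule sum_mono)
    fix kl assume "kl \<in> ?KK"
    then have "prob (?J kl) = prob (crossing (x + \<alpha> *\<^sub>R fst kl) \<alpha>) * prob (crossing (x + \<alpha> *\<^sub>R snd kl) \<alpha>)"
      using \<alpha>0 by (intro prob_crossing_Int near_disjoint) auto
    also have "\<dots> \<le> p * p" by (intro mult_mono p p0 measure_nonneg)
    finally show "prob (?J kl) \<le> p\<^sup>2" by (simp add: power2_eq_square)
  qed
  also have "\<dots> \<le> (card K)\<^sup>2 * p\<^sup>2"
  proof -
    have "card ?KK \<le> card (K \<times> K)" using K(1) by (intro card_mono) auto
    also have "\<dots> = (card K)\<^sup>2" by (simp add: card_cartesian_product power2_eq_square)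
    finally have "real (card ?KK) \<le> real ((card K)\<^sup>2)" by (rule of_nat_mono)
    then show ?thesis unfolding sum_constant by (rule mult_right_mono) simp
  qed
  finally show ?thesis by simp
qed

text \<open>
  A crossing needs at least one point near \<open>x\<close>.
\<close>

lemma prob_crossing_base:
  assumes \<alpha>: "12 * \<eta> \<le> \<alpha>"
  shows "prob (crossing x \<alpha>) \<le> lam * unit_ball_vol CARD('d) * (2 * \<alpha>) ^ CARD('d)"
proof -
  have \<alpha>0: "0 < \<alpha>" using \<alpha> \<eta> by linarith
  interpret N: prob_space \<nu> using \<nu> by (simp add: radius_law_def)
  let ?A = "shadow x (\<lambda>r. 2 * \<alpha>)"
  have A: "?A \<in> sets \<mu>" by (intro sets_shadow[OF \<nu>]) auto
  have "emeasure \<mu> ?A = ennreal (lam * unit_ball_vol CARD('d)) * (\<integral>\<^sup>+ r. ennreal ((2 * \<alpha>) ^ CARD('d)) \<partial>\<nu>)"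
    using \<alpha>0 by (intro emeasure_shadow[OF \<nu> lam]) auto
  also have "\<dots> = ennreal (lam * unit_ball_vol CARD('d) * (2 * \<alpha>) ^ CARD('d))"
    using \<alpha>0 lam by (simp add: N.emeasure_space_1 ennreal_mult' unit_ball_vol_nonneg)
  finally have em: "emeasure \<mu> ?A = ennreal (lam * unit_ball_vol CARD('d) * (2 * \<alpha>) ^ CARD('d))" .
  then have fin: "emeasure \<mu> ?A < \<infinity>" by simp
  have "crossing x \<alpha> \<subseteq> {\<omega> \<in> space P. \<omega> \<inter> ?A \<noteq> {}}"
  proof
    fix \<omega> assume \<omega>: "\<omega> \<in> crossing x \<alpha>"
    then obtain a b where a: "dist (centre a) x \<le> \<alpha>" and b: "2 * \<alpha> \<le> dist (centre b) x"
      and ab: "(a, b) \<in> (link centre rad (occ \<omega> \<inter> near centre rad x \<alpha>))\<^sup>*"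
      unfolding crossing_def crosses_def by blast
    have "a \<noteq> b" using a b \<alpha>0 by auto
    then have "a \<in> occ \<omega>" using rtrancl_link_in[OF ab] by auto
    then obtain c r where cr: "(c, r) \<in> \<omega>" "(c, r) \<in> cell a" by (auto simp: occ_def)
    have "dist c x < 2 * \<alpha>"
      using in_cell[OF cr(2)] a \<alpha> dist_triangle[of c x "centre a"] \<eta> by linarith
    then have "(c, r) \<in> ?A" using in_cell[OF cr(2)] by (auto simp: shadow_def)
    then show "\<omega> \<in> {\<omega> \<in> space P. \<omega> \<inter> ?A \<noteq> {}}" using cr \<omega> by (auto simp: crossing_def)
  qed
  then have "prob (crossing x \<alpha>) \<le> prob {\<omega> \<in> space P. \<omega> \<inter> ?A \<noteq> {}}"
    by (intro finite_measure_mono prob_hit_le(1)[OF A fin])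
  also have "\<dots> \<le> measure \<mu> ?A" by (rule prob_hit_le(2)[OF A fin])
  also have "\<dots> = lam * unit_ball_vol CARD('d) * (2 * \<alpha>) ^ CARD('d)"
    using em \<alpha>0 lam by (simp add: measure_def unit_ball_vol_nonneg)
  finally show ?thesis .
qed

lemma cluster_diameter_le:
  assumes \<omega>: "\<omega> \<in> space P" and \<alpha>: "12 * \<eta> \<le> \<alpha>"
    and G: "\<omega> \<notin> crossing 0 \<alpha>" and T: "\<omega> \<inter> giants 0 \<alpha> = {}"
  shows "cluster_diameter \<omega> \<le> ennreal (6 * \<alpha>)"
proof -
  have \<alpha>0: "0 < \<alpha>" using \<alpha> \<eta> by linarith
  have small: "rad z < max (\<alpha> / 2) (norm (centre z) / 10)" if z: "z \<in> occ \<omega>" for z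
  proof (rule ccontr)
    assume "\<not> rad z < max (\<alpha> / 2) (norm (centre z) / 10)"
    then have *: "\<alpha> / 2 \<le> rad z" "norm (centre z) \<le> 10 * rad z" by (auto simp: max_def split: if_splits)
    obtain c r where cr: "(c, r) \<in> \<omega>" "(c, r) \<in> cell z"
      using z by (auto simp: occ_def)
    note c = in_cell[OF cr(2)]
    have "norm c \<le> norm (centre z) + dist c (centre z)" unfolding dist_norm by norm
    then have "dist c 0 < 125 * r" using c * \<alpha> by simp
    then have "(c, r) \<in> giants 0 \<alpha>" using c * \<alpha> by (simp add: in_giants)
    then show False using T cr by auto
  qed
  have le: "norm y \<le> 3 * \<alpha>" if "y \<in> cluster \<omega>" for y
  proof (rule ccontr)
    assume "\<not> norm y \<le> 3 * \<alpha>"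
    then have "crosses centre rad 0 \<alpha> (occ \<omega>)"
      using that cluster_subset[OF \<omega>] small \<alpha>0 by (intro crosses_of_escape[of y]) auto
    then show False using G \<omega> by (simp add: crossing_def)
  qed
  show ?thesis
    unfolding cluster_diameter_def
  proof (intro SUP_least ennreal_leI)
    fix x y assume "x \<in> cluster \<omega>" "y \<in> cluster \<omega>"
    then show "norm (x - y) \<le> 6 * \<alpha>" using le[of x] le[of y] norm_triangle_ineq4[of x y] by linarith
  qed
qed

end

section \<open>From crossings to moments of the diameter\<close>

context discretised
begin

lemma emeasure_giants:
  "emeasure \<mu> (giants x \<alpha>) = ennreal (lam * unit_ball_vol CARD('d) * 125 ^ CARD('d)) *
     (\<integral>\<^sup>+ r. ennreal (if \<alpha> / 4 \<le> r then r ^ CARD('d) else 0) \<partial>\<nu>)"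
proof -
  have [measurable]: "(\<lambda>r. ennreal (if \<alpha> / 4 \<le> r then r ^ CARD('d) else 0)) \<in> borel_measurable \<nu>"
    by (rule measurable_radius_law[OF \<nu>]) measurable
  have "emeasure \<mu> (giants x \<alpha>) = ennreal (lam * unit_ball_vol CARD('d)) *
      (\<integral>\<^sup>+ r. ennreal ((if \<alpha> / 4 \<le> r then 125 * r else 0) ^ CARD('d)) \<partial>\<nu>)"
    unfolding giants_def by (intro emeasure_shadow[OF \<nu> lam]) auto
  also have "(\<integral>\<^sup>+ r. ennreal ((if \<alpha> / 4 \<le> r then 125 * r else 0) ^ CARD('d)) \<partial>\<nu>) =
      (\<integral>\<^sup>+ r. ennreal (125 ^ CARD('d)) * ennreal (if \<alpha> / 4 \<le> r then r ^ CARD('d) else 0) \<partial>\<nu>)"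
    by (intro nn_integral_cong)
      (auto simp: space_radius_law[OF \<nu>] power_mult_distrib simp flip: ennreal_mult')
  also have "\<dots> = ennreal (125 ^ CARD('d)) * (\<integral>\<^sup>+ r. ennreal (if \<alpha> / 4 \<le> r then r ^ CARD('d) else 0) \<partial>\<nu>)"
    by (rule nn_integral_cmult) measurable
  finally show ?thesis
    using lam by (simp add: ennreal_mult' unit_ball_vol_nonneg mult.assoc)
qed

lemma emeasure_giants_le:
  "emeasure \<mu> (giants x \<alpha>) \<le>
     ennreal (lam * unit_ball_vol CARD('d) * 125 ^ CARD('d)) * radius_moment \<nu> CARD('d)"
  unfolding emeasure_giants radius_moment_def
  by (intro mult_left_mono nn_integral_mono)
    (auto simp: space_radius_law[OF \<nu>] powr_realpow)

text \<open>
  By Fubini the sum is an integral over \<open>\<nu>\<close>, in which a radius \<open>r\<close> receives the factor \<open>r\<^sup>d\<close> and the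
  geometric weights of the scales below \<open>4r\<close>, together of order \<open>r\<^sup>d\<close> times \<open>r\<^sup>s\<close>.
\<close>

lemma suminf_giants:
  fixes s :: real
  assumes s: "s > 0" and m: "radius_moment \<nu> (CARD('d) + s) < \<infinity>" and \<alpha>: "\<alpha> > 0"
  shows "(\<Sum>n. ennreal ((10 powr s) ^ n) * emeasure \<mu> (giants 0 (10 ^ n * \<alpha>))) < \<infinity>"
proof -
  define q :: real where "q = 10 powr s"
  have q: "1 < q" unfolding q_def using powr_less_mono[of 0 s 10] s by simp
  define k where "k = lam * unit_ball_vol CARD('d) * 125 ^ CARD('d)"
  define A where "A = q / (q - 1) * (4 / \<alpha>) powr s"
  have A: "0 \<le> A" using q \<alpha> by (simp add: A_def)
  let ?f = "\<lambda>n r. if 10 ^ n * \<alpha> / 4 \<le> r then r ^ CARD('d) else 0"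
  have [measurable]: "(\<lambda>r. ennreal (?f n r)) \<in> borel_measurable \<nu>"
    "(\<lambda>r. ennreal (r powr p)) \<in> borel_measurable \<nu>" for n p
    by (rule measurable_radius_law[OF \<nu>]; measurable)+
  have cmult: "(\<integral>\<^sup>+ r. ennreal (q ^ n) * ennreal (?f n r) \<partial>\<nu>) = ennreal (q ^ n) * (\<integral>\<^sup>+ r. ennreal (?f n r) \<partial>\<nu>)" for n
    by (rule nn_integral_cmult) measurable
  have cmult': "(\<integral>\<^sup>+ r. ennreal A * ennreal (r powr (CARD('d) + s)) \<partial>\<nu>) = ennreal A * (\<integral>\<^sup>+ r. ennreal (r powr (CARD('d) + s)) \<partial>\<nu>)"
    by (rule nn_integral_cmult) measurable
  have swap: "(\<integral>\<^sup>+ r. (\<Sum>n. ennreal (q ^ n) * ennreal (?f n r)) \<partial>\<nu>) = (\<Sum>n. \<integral>\<^sup>+ r. ennreal (q ^ n) * ennreal (?f n r) \<partial>\<nu>)"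
    by (rule nn_integral_suminf) measurable
  have "(\<Sum>n. ennreal (q ^ n) * emeasure \<mu> (giants 0 (10 ^ n * \<alpha>)))
      = (\<Sum>n. ennreal k * (\<integral>\<^sup>+ r. ennreal (q ^ n) * ennreal (?f n r) \<partial>\<nu>))"
    unfolding emeasure_giants k_def[symmetric] cmult by (simp only: mult_ac)
  also have "\<dots> = ennreal k * (\<integral>\<^sup>+ r. (\<Sum>n. ennreal (q ^ n) * ennreal (?f n r)) \<partial>\<nu>)"
    by (simp only: swap ennreal_suminf_cmult)
  also have "\<dots> \<le> ennreal k * (\<integral>\<^sup>+ r. ennreal A * ennreal (r powr (CARD('d) + s)) \<partial>\<nu>)"
  proof (intro mult_left_mono nn_integral_mono suminf_le_const)
    fix r N assume "r \<in> space \<nu>"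
    then have r: "0 < r" by (simp add: space_radius_law[OF \<nu>])
    have eq: "10 ^ n * \<alpha> / 4 \<le> r \<longleftrightarrow> 10 ^ n \<le> 4 * r / \<alpha>" for n :: nat
      using \<alpha> by (simp add: field_simps)
    have "(\<Sum>n<N. ennreal (q ^ n) * ennreal (?f n r)) = (\<Sum>n<N. ennreal (q ^ n * ?f n r))"
      using q r by (intro sum.cong refl) (simp add: ennreal_mult')
    also have "\<dots> = ennreal (\<Sum>n<N. q ^ n * ?f n r)"
      using q r by (intro sum_ennreal) simp
    also have "(\<Sum>n<N. q ^ n * ?f n r) = r ^ CARD('d) * (\<Sum>n<N. if 10 ^ n \<le> 4 * r / \<alpha> then q ^ n else 0)"
      unfolding sum_distrib_left eq by (intro sum.cong) auto
    also have "\<dots> \<le> r ^ CARD('d) * (q / (q - 1) * (4 * r / \<alpha>) powr s)"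
      unfolding q_def using r s \<alpha> by (intro mult_left_mono geometric_layers_le) auto
    also have "\<dots> = A * r powr (CARD('d) + s)"
      using r \<alpha> by (simp add: A_def powr_mult powr_divide powr_add powr_realpow)
    finally show "(\<Sum>n<N. ennreal (q ^ n) * ennreal (?f n r)) \<le> ennreal A * ennreal (r powr (CARD('d) + s))"
      using A by (simp add: ennreal_leI flip: ennreal_mult')
  qed auto
  also have "\<dots> = ennreal k * (ennreal A * radius_moment \<nu> (CARD('d) + s))"
    unfolding radius_moment_def by (simp only: cmult')
  also have "\<dots> < \<infinity>" using m by (simp add: ennreal_mult_less_top)
  finally show ?thesis by (simp add: q_def)
qed

text \<open>
  At the first scale \<open>\<alpha>\<^sub>n\<close> without a crossing or a giant the diameter is at most \<open>6\<alpha>\<^sub>n\<close>, and the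
  preceding scale has contributed a term of the same order; the summand \<open>1\<close> is for \<open>n = 0\<close>. The bound
  is pointwise and its right-hand side is measurable, so it survives integration.
\<close>

lemma diameter_moment_le:
  assumes s: "s > 0" and \<alpha>: "12 * \<eta> \<le> \<alpha>" and fin: "\<And>n. emeasure \<mu> (giants 0 (10 ^ n * \<alpha>)) < \<infinity>"
  shows "diameter_moment P s \<le> ennreal ((60 * \<alpha>) powr s) *
    (1 + (\<Sum>n. ennreal ((10 powr s) ^ n * (prob (crossing 0 (10 ^ n * \<alpha>)) + measure \<mu> (giants 0 (10 ^ n * \<alpha>))))))"
proof -
  define q :: real where "q = 10 powr s"
  have q: "1 < q" unfolding q_def using powr_less_mono[of 0 s 10] s by simp
  have \<alpha>0: "0 < \<alpha>" using \<alpha> \<eta> by linarith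
  define A where "A = (60 * \<alpha>) powr s"
  define E where "E n = crossing 0 (10 ^ n * \<alpha>) \<union> {\<omega> \<in> space P. \<omega> \<inter> giants 0 (10 ^ n * \<alpha>) \<noteq> {}}" for n
  have E [measurable]: "E n \<in> events" for n
    unfolding E_def by (intro sets.Un crossing_in_events prob_hit_le(1)[OF sets_giants fin])
  have power: "ennreal_powr x s \<le> ennreal (y powr s)" if "x \<le> ennreal y" "0 \<le> y" for x y
  proof -
    have "x \<noteq> \<infinity>" using that(1) by (metis ennreal_less_top infinity_ennreal_def leD)
    moreover have "enn2real x \<le> y" using that by (simp add: enn2real_leI)
    ultimately show ?thesis using s by (auto simp: ennreal_powr_def intro!: ennreal_leI powr_mono2)
  qed
  \<comment> \<open>The truncated \<open>n - 1\<close> makes the case \<open>n = 0\<close> fit, with room to spare.\<close>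
  have layer: "(6 * (10 ^ n * \<alpha>)) powr s \<le> A * q ^ (n - 1)" for n
  proof -
    have "(6 * (10 ^ n * \<alpha>)) powr s \<le> (60 * \<alpha> * 10 ^ (n - 1)) powr s"
      using \<alpha>0 s by (cases n) (auto intro!: powr_mono2)
    also have "\<dots> = A * q ^ (n - 1)"
      using \<alpha>0 by (simp add: A_def q_def powr_mult powr_powr powr_realpow[symmetric] mult.commute)
    finally show ?thesis .
  qed
  have big: "12 * \<eta> \<le> 10 ^ n * \<alpha>" for n
    using \<alpha>0 by (intro order_trans[OF \<alpha>]) simp
  have pt: "ennreal_powr (cluster_diameter \<omega>) s \<le>
      ennreal A * (1 + (\<Sum>n. ennreal (q ^ n) * indicator (E n) \<omega>))" if \<omega>: "\<omega> \<in> space P" for \<omega>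
  proof (cases "\<exists>n. \<omega> \<notin> E n")
    case True
    define n where "n = (LEAST n. \<omega> \<notin> E n)"
    have n: "\<omega> \<notin> E n" unfolding n_def using LeastI_ex[OF True] .
    have "cluster_diameter \<omega> \<le> ennreal (6 * (10 ^ n * \<alpha>))"
      using n \<omega> by (intro cluster_diameter_le[OF \<omega> big]) (auto simp: E_def)
    then have "ennreal_powr (cluster_diameter \<omega>) s \<le> ennreal ((6 * (10 ^ n * \<alpha>)) powr s)"
      using \<alpha>0 by (intro power) auto
    also have "\<dots> \<le> ennreal (A * q ^ (n - 1))" by (intro ennreal_leI layer)
    also have "\<dots> = ennreal A * ennreal (q ^ (n - 1))"
      using q by (simp add: ennreal_mult'')
    also have "ennreal (q ^ (n - 1)) \<le> 1 + (\<Sum>n. ennreal (q ^ n) * indicator (E n) \<omega>)"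
    proof (cases n)
      case (Suc m)
      then have "\<omega> \<in> E m" using not_less_Least[of m "\<lambda>n. \<omega> \<notin> E n"] by (simp add: n_def)
      then have "ennreal (q ^ (n - 1)) = ennreal (q ^ m) * indicator (E m) \<omega>" using Suc by simp
      also have "\<dots> \<le> (\<Sum>n. ennreal (q ^ n) * indicator (E n) \<omega>)"
        using sum_le_suminf[of "\<lambda>n. ennreal (q ^ n) * indicator (E n) \<omega>" "{m}"]
        by (simp only: summableI finite.intros sum.insert sum.empty add_0_right empty_iff not_False_eq_True zero_le
            simp_thms)
      finally show ?thesis by (simp add: add_increasing)
    qed simp
    finally show ?thesis by (simp add: mult_left_mono)
  next
    case False
    have "(\<Sum>n. ennreal (q ^ n) * indicator (E n) \<omega>) = \<top>"
    proof (rule ccontr)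
      assume "(\<Sum>n. ennreal (q ^ n) * indicator (E n) \<omega>) \<noteq> \<top>"
      then have "(\<Sum>n. ennreal (q ^ n)) \<noteq> \<top>" using False by simp
      then have "summable (\<lambda>n. q ^ n)" using q by (intro summable_suminf_not_top) auto
      then show False using q by (simp add: summable_geometric_iff)
    qed
    moreover have "0 < A" using \<alpha>0 by (simp add: A_def)
    ultimately show ?thesis by (simp add: ennreal_mult_top)
  qed
  have "diameter_moment P s \<le> (\<integral>\<^sup>+ \<omega>. ennreal A * (1 + (\<Sum>n. ennreal (q ^ n) * indicator (E n) \<omega>)) \<partial>P)"
    unfolding diameter_moment_def by (intro nn_integral_mono pt)
  also have "\<dots> = ennreal A * (1 + (\<Sum>n. ennreal (q ^ n) * emeasure P (E n)))"
    by (simp add: nn_integral_cmult nn_integral_add nn_integral_suminf emeasure_space_1)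
  also have "\<dots> \<le> ennreal A * (1 + (\<Sum>n. ennreal (q ^ n * (prob (crossing 0 (10 ^ n * \<alpha>)) + measure \<mu> (giants 0 (10 ^ n * \<alpha>))))))"
  proof (intro mult_left_mono add_left_mono suminf_le summableI)
    fix n
    have "prob (E n) \<le> prob (crossing 0 (10 ^ n * \<alpha>)) + measure \<mu> (giants 0 (10 ^ n * \<alpha>))"
      unfolding E_def
      by (rule order_trans[OF measure_Un_le[OF crossing_in_events prob_hit_le(1)[OF sets_giants fin]]])
        (simp add: prob_hit_le(2)[OF sets_giants fin])
    then show "ennreal (q ^ n) * emeasure P (E n)
      \<le> ennreal (q ^ n * (prob (crossing 0 (10 ^ n * \<alpha>)) + measure \<mu> (giants 0 (10 ^ n * \<alpha>))))"
      using q by (simp add: emeasure_eq_measure ennreal_leI flip: ennreal_mult')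
  qed auto
  finally show ?thesis by (simp add: A_def q_def)
qed

text \<open>
  The scales are \<open>10\<^sup>n \<cdot> 12\<eta>\<close>. The two smallness conditions are the hypotheses of
  \<open>scale_bound_summable\<close> for the error terms and for the initial scale.
\<close>

lemma diameter_moment_finite_of_mesh:
  fixes K :: "(real ^ 'd) set" and s :: real
  assumes K: "finite K" "K \<noteq> {}" "cball 0 30 \<subseteq> (\<Union>k\<in>K. ball k 1)"
    and s: "s > 0" and m: "radius_moment \<nu> (CARD('d) + s) < \<infinity>"
    and small: "ennreal lam * radius_moment \<nu> CARD('d)
        \<le> ennreal (1 / (4 * (card K)\<^sup>2 * unit_ball_vol CARD('d) * 125 ^ CARD('d)))"
    and \<eta>_small: "(card K)\<^sup>2 * (lam * unit_ball_vol CARD('d) * (24 * \<eta>) ^ CARD('d)) \<le> 1/2"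
  shows "diameter_moment P s < \<infinity>"
proof -
  define \<alpha> where "\<alpha> = 12 * \<eta>"
  have \<alpha>: "0 < \<alpha>" using \<eta> by (simp add: \<alpha>_def)
  define C where "C = (real (card K))\<^sup>2"
  have C: "0 < C" using K by (simp add: C_def)
  define p where "p = lam * unit_ball_vol CARD('d) * (2 * \<alpha>) ^ CARD('d)"
  define e where "e n = measure \<mu> (giants 0 (10 ^ n * \<alpha>))" for n
  define v where "v = unit_ball_vol CARD('d)"
  have v: "0 < v" by (simp add: v_def unit_ball_vol_pos)
  let ?b = "scale_bound C p e"
  have em: "emeasure \<mu> (giants x \<beta>) \<le> ennreal (1 / (4 * C))" for x \<beta>
  proof -
    have "emeasure \<mu> (giants x \<beta>) \<le> ennreal (v * 125 ^ CARD('d)) * (ennreal lam * radius_moment \<nu> CARD('d))"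
      using emeasure_giants_le[of x \<beta>] lam v
      by (simp add: v_def ennreal_mult' mult_ac)
    also have "\<dots> \<le> ennreal (v * 125 ^ CARD('d)) * ennreal (1 / (4 * C * v * 125 ^ CARD('d)))"
      using small by (intro mult_left_mono) (auto simp: C_def v_def)
    also have "\<dots> = ennreal (1 / (4 * C))"
      using v C by (simp flip: ennreal_mult')
    finally show ?thesis .
  qed
  have fin: "emeasure \<mu> (giants x \<beta>) < \<infinity>" for x \<beta>
    using le_less_trans[OF em] by simp
  have e_le: "C * e n \<le> 1/4" for n
  proof -
    have "e n \<le> 1 / (4 * C)"
      unfolding e_def measure_def using em C by (intro enn2real_leI) auto
    then show ?thesis using C by (simp add: field_simps)
  qed
  have same: "measure \<mu> (giants x \<beta>) = measure \<mu> (giants 0 \<beta>)" for x \<beta>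
    unfolding measure_def emeasure_giants ..
  have pb: "prob (crossing x (10 ^ n * \<alpha>)) \<le> ?b n" for n x
  proof (induction n arbitrary: x)
    case 0
    then show ?case using prob_crossing_base[of \<alpha> x] by (simp add: p_def \<alpha>_def)
  next
    case (Suc n)
    have "12 * \<eta> \<le> 10 ^ n * \<alpha>"
      using \<alpha> unfolding \<alpha>_def[symmetric] by simp
    then have "prob (crossing x (10 * (10 ^ n * \<alpha>))) \<le> (card K)\<^sup>2 * (?b n)\<^sup>2 + measure \<mu> (giants x (10 ^ n * \<alpha>))"
      by (intro prob_crossing_rec K Suc.IH fin)
    moreover have "measure \<mu> (giants x (10 ^ n * \<alpha>)) = e n"
      unfolding e_def by (rule same)
    ultimately show ?case
      by (simp add: C_def mult.assoc)
  qed
  have sum_e: "summable (\<lambda>n. (10 powr s) ^ n * e n)"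
  proof (rule summable_suminf_not_top)
    have "(\<Sum>n. ennreal ((10 powr s) ^ n * e n)) = (\<Sum>n. ennreal ((10 powr s) ^ n) * emeasure \<mu> (giants 0 (10 ^ n * \<alpha>)))"
      using fin by (intro suminf_cong) (simp add: e_def ennreal_mult' emeasure_eq_ennreal_measure less_top)
    then show "(\<Sum>n. ennreal ((10 powr s) ^ n * e n)) \<noteq> \<top>" using suminf_giants[OF s m \<alpha>] by simp
  qed (simp add: e_def)
  have sum_b: "summable (\<lambda>n. (10 powr s) ^ n * ?b n)"
  proof (rule scale_bound_summable[OF C _ _ _ e_le _ sum_e])
    show "0 \<le> p" using lam v \<alpha> by (simp add: p_def v_def)
    show "C * p \<le> 1/2" using \<eta>_small by (simp add: C_def p_def \<alpha>_def)
    show "1 \<le> (10::real) powr s" using s by (simp add: ge_one_powr_ge_zero)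
  qed (simp add: e_def)
  have "summable (\<lambda>n. (10 powr s) ^ n * (prob (crossing 0 (10 ^ n * \<alpha>)) + e n))"
  proof (rule summable_comparison_test'[OF summable_add[OF sum_b sum_e]])
    fix n
    show "norm ((10 powr s) ^ n * (prob (crossing 0 (10 ^ n * \<alpha>)) + e n)) \<le> (10 powr s) ^ n * ?b n + (10 powr s) ^ n * e n"
      using pb[of 0 n] by (simp add: e_def distrib_left[symmetric] abs_mult)
  qed
  then have "(\<Sum>n. ennreal ((10 powr s) ^ n * (prob (crossing 0 (10 ^ n * \<alpha>)) + e n))) \<noteq> \<top>"
    by (rule ennreal_suminf_neq_top) (simp add: e_def)
  then have "(\<Sum>n. ennreal ((10 powr s) ^ n * (prob (crossing 0 (10 ^ n * \<alpha>)) + e n))) < \<top>"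
    by (simp only: less_top[symmetric] not_False_eq_True)
  then have fin_sum: "ennreal ((60 * \<alpha>) powr s) *
    (1 + (\<Sum>n. ennreal ((10 powr s) ^ n * (prob (crossing 0 (10 ^ n * \<alpha>)) + e n)))) < \<infinity>"
    by (simp add: ennreal_mult_less_top)
  have "12 * \<eta> \<le> \<alpha>" by (simp add: \<alpha>_def)
  from diameter_moment_le[OF s this fin] show ?thesis
    unfolding e_def[symmetric] using fin_sum by (rule le_less_trans)
qed

end

section \<open>Large balls covering the origin\<close>

lemma cluster_diameter_ge:
  fixes \<omega> :: "((real ^ 'd::finite) \<times> real) set"
  assumes cr: "(c, r) \<in> \<omega>" "norm c < r"
  shows "ennreal (r / 2) \<le> cluster_diameter \<omega>"
proof -
  have r: "0 < r" using cr(2) norm_ge_zero[of c] by linarith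
  have "ball c r \<subseteq> cluster \<omega>"
    unfolding cluster_def
  proof (rule connected_component_maximal)
    show "0 \<in> ball c r" using cr by simp
    show "ball c r \<subseteq> occupied \<omega>" using cr by (force simp: occupied_def)
  qed simp
  define y where "y = c + (r / 2) *\<^sub>R axis undefined 1"
  have n: "norm (y - c) = r / 2" using r by (simp add: y_def)
  have "y \<in> cluster \<omega>" "c \<in> cluster \<omega>"
    using \<open>ball c r \<subseteq> cluster \<omega>\<close> r n by (auto simp: dist_norm norm_minus_commute)
  then show ?thesis
    unfolding cluster_diameter_def n[symmetric] by (intro SUP_upper2[of y] SUP_upper2[of c]) auto
qed

lemma ennreal_powr_ge:
  assumes "ennreal y \<le> x" "0 \<le> y" "0 < s" shows "ennreal (y powr s) \<le> ennreal_powr x s"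
proof (cases "x = \<infinity>")
  case False
  then have "y \<le> enn2real x"
    using assms by (metis ennreal_enn2real ennreal_le_iff enn2real_nonneg infinity_ennreal_def less_top)
  then show ?thesis using False assms by (auto simp: ennreal_powr_def intro!: ennreal_leI powr_mono2)
qed (simp add: ennreal_powr_def)

lemma ex_dyadic_layer:
  fixes r :: real assumes "1 \<le> r" shows "\<exists>n. 2 ^ n \<le> r \<and> r < 2 ^ Suc n"
proof -
  obtain m where m: "r < 2 ^ m" using real_arch_pow[of 2 r] by auto
  define n where "n = (LEAST m. r < 2 ^ m)"
  have n: "r < 2 ^ n" unfolding n_def by (rule LeastI[of _ m]) (rule m)
  then obtain k where k: "n = Suc k" using assms by (cases n) auto
  have "\<not> r < 2 ^ k" using not_less_Least[of k "\<lambda>m. r < 2 ^ m"] k by (simp add: n_def)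
  then show ?thesis using n k by (intro exI[of _ k]) auto
qed

context boolean_percolation
begin

definition origin_layer :: "nat \<Rightarrow> ((real ^ 'd) \<times> real) set" where
  "origin_layer n = shadow 0 (\<lambda>r. if 2 ^ n \<le> r \<and> r < 2 ^ Suc n then r else 0)"

definition origin_tail :: "nat \<Rightarrow> ((real ^ 'd) \<times> real) set" where
  "origin_tail n = shadow 0 (\<lambda>r. if 2 ^ n \<le> r then r else 0)"

lemma in_origin_layer: "(c, r) \<in> origin_layer n \<longleftrightarrow> 0 < r \<and> norm c < r \<and> 2 ^ n \<le> r \<and> r < 2 ^ Suc n"
  by (auto simp: origin_layer_def shadow_def split: if_splits)

lemma in_origin_tail: "(c, r) \<in> origin_tail n \<longleftrightarrow> 0 < r \<and> norm c < r \<and> 2 ^ n \<le> r"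
  by (auto simp: origin_tail_def shadow_def split: if_splits)

lemma sets_origin_layer: "origin_layer n \<in> sets \<mu>" and sets_origin_tail: "origin_tail n \<in> sets \<mu>"
  unfolding origin_layer_def origin_tail_def by (intro sets_shadow[OF \<nu>]; measurable)+

lemma origin_layer_disjoint: "m \<noteq> n \<Longrightarrow> origin_layer m \<inter> origin_layer n = {}"
proof (induction m n rule: linorder_wlog)
  case (le m n)
  then have "(2::real) ^ Suc m \<le> 2 ^ n" by (intro power_increasing) auto
  then show ?case by (auto simp: in_origin_layer)
qed (simp add: Int_commute)

lemma origin_layer_subset: "origin_layer n \<subseteq> origin_tail 0"
proof
  fix p assume "p \<in> origin_layer n"
  then obtain c r where p: "p = (c, r)" "0 < r" "norm c < r" "2 ^ n \<le> r"
    by (cases p) (auto simp: in_origin_layer)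
  have "1 \<le> r" by (rule order_trans[OF _ p(4)]) simp
  then show "p \<in> origin_tail 0" using p by (simp add: in_origin_tail)
qed

lemma power_diameter_ge:
  assumes "s > 0" "\<omega> \<inter> origin_tail n \<noteq> {}"
  shows "ennreal ((2 ^ n / 2) powr s) \<le> ennreal_powr (cluster_diameter \<omega>) s"
proof -
  obtain c r where "(c, r) \<in> \<omega>" "norm c < r" "2 ^ n \<le> r" using assms by (auto simp: in_origin_tail)
  then have "ennreal (2 ^ n / 2) \<le> ennreal (r / 2)" "ennreal (r / 2) \<le> cluster_diameter \<omega>"
    by (auto intro!: ennreal_leI cluster_diameter_ge)
  then have "ennreal (2 ^ n / 2) \<le> cluster_diameter \<omega>" by (rule order_trans)
  then show ?thesis using assms by (intro ennreal_powr_ge) auto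
qed

text \<open>
  Balls with bounded radii covering \<open>0\<close> are finite in mean, so if the whole family is infinite in
  mean then so is each of its tails. Almost surely all tails are then hit, and \<open>D\<^sup>s\<close> is at least any
  constant.
\<close>

lemma emeasure_origin_tail_finite:
  assumes s: "s > 0" and fin: "diameter_moment P s < \<infinity>"
  shows "emeasure \<mu> (origin_tail 0) < \<infinity>"
proof (rule ccontr)
  assume "\<not> emeasure \<mu> (origin_tail 0) < \<infinity>"
  then have inf0: "emeasure \<mu> (origin_tail 0) = \<infinity>" by (simp add: less_top[symmetric])
  interpret N: prob_space \<nu> using \<nu> by (simp add: radius_law_def)
  have inf: "emeasure \<mu> (origin_tail n) = \<infinity>" for n
  proof -
    let ?S = "shadow (0 :: real ^ 'd) (\<lambda>r. 2 ^ n)"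
    have S: "?S \<in> sets \<mu>" by (intro sets_shadow[OF \<nu>]) auto
    have "emeasure \<mu> ?S = ennreal (lam * unit_ball_vol CARD('d)) * (\<integral>\<^sup>+ r. ennreal ((2 ^ n) ^ CARD('d)) \<partial>\<nu>)"
      by (intro emeasure_shadow[OF \<nu> lam]) auto
    then have "emeasure \<mu> ?S < \<infinity>" by (simp add: N.emeasure_space_1 ennreal_mult_less_top)
    moreover have "emeasure \<mu> (origin_tail 0) \<le> emeasure \<mu> (origin_tail n \<union> ?S)"
      using S sets_origin_tail by (intro emeasure_mono sets.Un) (force simp: in_origin_tail shadow_def)+
    moreover have "emeasure \<mu> (origin_tail n \<union> ?S) \<le> emeasure \<mu> (origin_tail n) + emeasure \<mu> ?S"
      using S sets_origin_tail by (intro emeasure_subadditive)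
    ultimately show ?thesis using inf0 by (auto simp: top_unique less_top)
  qed
  have ge: "ennreal ((2 ^ n / 2) powr s) \<le> diameter_moment P s" for n
  proof -
    have "AE \<omega> in P. ennreal ((2 ^ n / 2) powr s) \<le> ennreal_powr (cluster_diameter \<omega>) s"
      using AE_num_points_infinite[OF sets_origin_tail inf, of n]
    proof eventually_elim
      case (elim \<omega>)
      then have "\<omega> \<inter> origin_tail n \<noteq> {}" using num_points_eq_0[of \<omega> "origin_tail n"] by auto
      then show ?case by (rule power_diameter_ge[OF s])
    qed
    from nn_integral_mono_AE[OF this] show ?thesis
      by (simp add: diameter_moment_def emeasure_space_1)
  qed
  obtain x where x: "0 \<le> x" "diameter_moment P s = ennreal x"
    using fin by (cases "diameter_moment P s") auto
  define q :: real where "q = 2 powr s"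
  have q: "1 < q" unfolding q_def using powr_less_mono[of 0 s 2] s by simp
  obtain n where "q * x < q ^ n" using real_arch_pow[OF q] by blast
  moreover have "(2 ^ n / 2) powr s = q ^ n / q"
    by (simp add: q_def powr_divide powr_powr powr_realpow[symmetric] mult.commute)
  ultimately have "x < (2 ^ n / 2) powr s" using q by (simp add: pos_less_divide_eq mult.commute)
  then show False using ge[of n] x by simp
qed

text \<open>
  Requiring a single point in the whole tail makes the events for different \<open>n\<close> disjoint, and the
  factor \<open>exp (- measure \<mu> (origin_tail 0))\<close> is the same for all of them.
\<close>

lemma single_layer_event:
  assumes fin: "emeasure \<mu> (origin_tail 0) < \<infinity>"
  defines "H \<equiv> \<lambda>n. {\<omega> \<in> space P. num_points \<omega> (origin_layer n) = 1 \<and> num_points \<omega> (origin_tail 0 - origin_layer n) = 0}"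
  shows "H n \<in> events"
    and "prob (H n) = measure \<mu> (origin_layer n) * exp (- measure \<mu> (origin_tail 0))"
proof -
  \<comment> \<open>A sequence of disjoint sets with only two relevant terms, in the form that \<open>indep_num_points\<close> speaks about.\<close>
  define A where "A i = (if i = 0 then origin_layer n else if i = 1 then origin_tail 0 - origin_layer n else {})" for i :: nat
  have A: "A i \<in> sets \<mu>" for i using sets_origin_layer sets_origin_tail by (auto simp: A_def)
  have Af: "emeasure \<mu> (A i) < \<infinity>" for i
  proof -
    have "A i \<subseteq> origin_tail 0" using origin_layer_subset by (auto simp: A_def)
    then show ?thesis using fin emeasure_mono[OF _ sets_origin_tail] le_less_trans by blast
  qed
  have "disjoint_family A" by (auto simp: disjoint_family_on_def A_def)
  from indep_num_points[OF A this]
  have ind: "indep_vars (\<lambda>_. borel) (\<lambda>i \<omega>. num_points \<omega> (A i)) UNIV" .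
  let ?B = "\<lambda>i::nat. {if i = 0 then 1 else 0 :: ennreal}"
  have H: "H n = (\<Inter>i\<in>{0, 1}. (\<lambda>\<omega>. num_points \<omega> (A i)) -` ?B i \<inter> space P)"
    by (auto simp: H_def A_def)
  have [measurable]: "(\<lambda>\<omega>. num_points \<omega> (A i)) \<in> borel_measurable P" for i
    by (rule measurable_num_points[OF A])
  show "H n \<in> events" unfolding H
    by (intro sets.finite_INT measurable_sets[of _ P borel]) auto
  have "prob (H n) = (\<Prod>i\<in>{0, 1}. prob ((\<lambda>\<omega>. num_points \<omega> (A i)) -` ?B i \<inter> space P))"
    unfolding H by (rule indep_varsD[OF ind]) auto
  also have "\<dots> = prob {\<omega> \<in> space P. num_points \<omega> (A 0) = of_nat 1} * prob {\<omega> \<in> space P. num_points \<omega> (A 1) = of_nat 0}"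
    by (simp add: vimage_def Int_def conj_commute)
  also have "\<dots> = measure \<mu> (A 0) * exp (- (measure \<mu> (A 0) + measure \<mu> (A 1)))"
    unfolding prob_num_points[OF A Af] minus_add_distrib exp_add by simp
  also have "measure \<mu> (A 0) + measure \<mu> (A 1) = measure \<mu> (A 0 \<union> A 1)"
    using Af[of 0] Af[of 1]
    by (intro measure_Union[symmetric] A) (simp_all only: less_top infinity_ennreal_def, auto simp: A_def)
  also have "A 0 \<union> A 1 = origin_tail 0" using origin_layer_subset by (auto simp: A_def)
  finally show "prob (H n) = measure \<mu> (origin_layer n) * exp (- measure \<mu> (origin_tail 0))" by (simp add: A_def)
qed

text \<open>
  The events \<open>H n\<close> of \<open>single_layer_event\<close> are disjoint, hence \<open>D\<^sup>s\<close> dominates the sum of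
  \<open>(2\<^sup>n/2)\<^sup>s\<close> over them, and their probabilities are proportional to the integrals of \<open>r\<^sup>d\<close> over the
  layers.
\<close>

lemma radius_moment_finite:
  fixes s :: real
  assumes s: "s > 0" and fin: "diameter_moment P s < \<infinity>"
  shows "radius_moment \<nu> (CARD('d) + s) < \<infinity>"
proof -
  note tail_fin = emeasure_origin_tail_finite[OF s fin]
  interpret N: prob_space \<nu> using \<nu> by (simp add: radius_law_def)
  define H where "H n = {\<omega> \<in> space P. num_points \<omega> (origin_layer n) = 1 \<and> num_points \<omega> (origin_tail 0 - origin_layer n) = 0}" for n
  note H = single_layer_event[OF tail_fin, folded H_def]
  note [measurable] = H(1)
  define q :: real where "q = 2 powr s"
  have q: "1 < q" unfolding q_def using powr_less_mono[of 0 s 2] s by simp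
  have qn: "(2 ^ n / 2) powr s = q ^ n / q" for n
    by (simp add: q_def powr_divide powr_powr powr_realpow[symmetric] mult.commute)
  define k where "k = lam * unit_ball_vol CARD('d)"
  have k: "0 < k" using lam by (simp add: k_def unit_ball_vol_pos)
  have one: "(\<Sum>n. ennreal (q ^ n / q) * indicator (H n) \<omega>) \<le> ennreal_powr (cluster_diameter \<omega>) s" for \<omega>
  proof (cases "\<exists>m. \<omega> \<in> H m")
    case True
    then obtain m where m: "\<omega> \<in> H m" by blast
    have "\<omega> \<notin> H n" if "n \<noteq> m" for n
    proof
      assume "\<omega> \<in> H n"
      then have "\<omega> \<inter> (origin_tail 0 - origin_layer n) = {}" by (simp add: H_def num_points_eq_0)
      moreover have "origin_layer m \<subseteq> origin_tail 0 - origin_layer n" using origin_layer_subset origin_layer_disjoint[OF that] by blast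
      ultimately have "num_points \<omega> (origin_layer m) = 0" by (auto simp: num_points_eq_0)
      then show False using m by (simp add: H_def)
    qed
    then have "(\<Sum>n. ennreal (q ^ n / q) * indicator (H n) \<omega>) = ennreal (q ^ m / q)"
      using m by (subst suminf_finite[of "{m}"]) auto
    moreover have "\<omega> \<inter> origin_tail m \<noteq> {}"
    proof -
      have "\<omega> \<inter> origin_layer m \<noteq> {}" using m num_points_eq_0[of \<omega> "origin_layer m"] by (auto simp: H_def)
      moreover have "origin_layer m \<subseteq> origin_tail m" by (auto simp: in_origin_layer in_origin_tail)
      ultimately show ?thesis by blast
    qed
    ultimately show ?thesis using power_diameter_ge[OF s] by (simp add: qn)
  qed simp
  have "(\<Sum>n. ennreal (q ^ n / q) * emeasure P (H n)) = (\<integral>\<^sup>+ \<omega>. (\<Sum>n. ennreal (q ^ n / q) * indicator (H n) \<omega>) \<partial>P)"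
    by (simp add: nn_integral_suminf nn_integral_cmult)
  also have "\<dots> \<le> diameter_moment P s"
    unfolding diameter_moment_def by (intro nn_integral_mono one)
  finally have sumH: "(\<Sum>n. ennreal (q ^ n / q) * emeasure P (H n)) < \<infinity>" using fin by simp
  \<comment> \<open>The integral of \<open>r\<^sup>d\<close> over the layer, without the factor \<open>k\<close> of the intensity.\<close>
  define I where "I n = (\<integral>\<^sup>+ r. ennreal (if 2 ^ n \<le> r \<and> r < 2 ^ Suc n then r ^ CARD('d) else 0) \<partial>\<nu>)" for n
  have [measurable]: "(\<lambda>r. ennreal (if 2 ^ n \<le> r \<and> r < 2 ^ Suc n then r ^ CARD('d) else 0)) \<in> borel_measurable \<nu>" for n
    by (rule measurable_radius_law[OF \<nu>]) measurable
  define c where "c = q * q * exp (measure \<mu> (origin_tail 0)) / k"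
  have c: "0 \<le> c" using q k by (simp add: c_def)
  have layer_term: "ennreal (q ^ Suc n) * I n = ennreal c * (ennreal (q ^ n / q) * emeasure P (H n))" for n
  proof -
    have "emeasure \<mu> (origin_layer n) = ennreal k * (\<integral>\<^sup>+ r. ennreal ((if 2 ^ n \<le> r \<and> r < 2 ^ Suc n then r else 0) ^ CARD('d)) \<partial>\<nu>)"
      unfolding origin_layer_def k_def by (intro emeasure_shadow[OF \<nu> lam]) auto
    also have "(\<integral>\<^sup>+ r. ennreal ((if 2 ^ n \<le> r \<and> r < 2 ^ Suc n then r else 0) ^ CARD('d)) \<partial>\<nu>) = I n"
      unfolding I_def by (intro nn_integral_cong) auto
    finally have em: "emeasure \<mu> (origin_layer n) = ennreal k * I n" .
    moreover have "emeasure \<mu> (origin_layer n) < \<infinity>"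
      using emeasure_mono[OF origin_layer_subset sets_origin_tail] tail_fin le_less_trans by blast
    ultimately have "I n \<noteq> \<top>" using k by (auto simp: ennreal_mult_top)
    then obtain i where i: "0 \<le> i" "I n = ennreal i" by (cases "I n") auto
    then have "measure \<mu> (origin_layer n) = k * i" using em k by (simp add: measure_def flip: ennreal_mult')
    then have "emeasure P (H n) = ennreal (k * i * exp (- measure \<mu> (origin_tail 0)))"
      by (simp add: emeasure_eq_measure H(2))
    then show ?thesis using q k i c
      by (simp add: c_def exp_minus field_simps flip: ennreal_mult')
  qed
  have "radius_moment \<nu> (CARD('d) + s) \<le>
      (\<integral>\<^sup>+ r. 1 + (\<Sum>n. ennreal (q ^ Suc n) * ennreal (if 2 ^ n \<le> r \<and> r < 2 ^ Suc n then r ^ CARD('d) else 0)) \<partial>\<nu>)"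
    unfolding radius_moment_def
  proof (rule nn_integral_mono)
    fix r assume "r \<in> space \<nu>"
    then have r: "0 < r" by (simp add: space_radius_law[OF \<nu>])
    let ?t = "\<lambda>n. ennreal (q ^ Suc n) * ennreal (if 2 ^ n \<le> r \<and> r < 2 ^ Suc n then r ^ CARD('d) else 0)"
    show "ennreal (r powr (CARD('d) + s)) \<le> 1 + suminf ?t"
    proof (cases "1 \<le> r")
      case True
      then obtain n where n: "2 ^ n \<le> r" "r < 2 ^ Suc n" using ex_dyadic_layer by blast
      have "r powr s \<le> (2 ^ Suc n) powr s" using n r s by (intro powr_mono2) auto
      also have "\<dots> = q ^ Suc n"
        by (simp only: q_def powr_realpow[symmetric] powr_powr mult.commute zero_less_numeral powr_gt_zero)
      finally have "r powr (CARD('d) + s) \<le> q ^ Suc n * r ^ CARD('d)"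
        using r by (simp add: powr_add powr_realpow mult.commute mult_left_mono)
      then have "ennreal (r powr (CARD('d) + s)) \<le> ?t n"
        using n q r by (simp add: ennreal_leI flip: ennreal_mult')
      also have "\<dots> = sum ?t {n}" by simp
      also have "\<dots> \<le> suminf ?t" by (rule sum_le_suminf) auto
      finally show ?thesis by (simp add: add_increasing)
    next
      case False
      then have "r powr (CARD('d) + s) \<le> 1" using r s powr_mono2[of "CARD('d) + s" r 1] by simp
      then show ?thesis by (intro add_increasing2) (auto simp: ennreal_le_1)
    qed
  qed
  also have "\<dots> = 1 + (\<Sum>n. ennreal (q ^ Suc n) * I n)"
    unfolding I_def by (simp add: nn_integral_add nn_integral_suminf nn_integral_cmult N.emeasure_space_1 del: power_Suc)
  also have "\<dots> = 1 + ennreal c * (\<Sum>n. ennreal (q ^ n / q) * emeasure P (H n))"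
    unfolding layer_term by simp
  also have "\<dots> < \<infinity>" using sumH by (simp add: ennreal_mult_less_top)
  finally show ?thesis .
qed

end

section \<open>Finiteness of the moments at low intensity\<close>

text \<open>
  The mesh is chosen last and may depend on \<open>lam\<close>; only the bound on \<open>lam\<close> times the moment of
  order \<open>d\<close> has to involve constants of the dimension alone.
\<close>

lemma diameter_moment_finite:
  fixes K :: "(real ^ 'd::finite) set" and P :: "((real ^ 'd) \<times> real) set measure" and s :: real
  assumes \<nu>: "radius_law \<nu>" and lam: "0 < lam" and P: "boolean_model P lam \<nu>"
    and K: "finite K" "K \<noteq> {}" "cball 0 30 \<subseteq> (\<Union>k\<in>K. ball k 1)"
    and s: "s > 0" and m: "radius_moment \<nu> (CARD('d) + s) < \<infinity>"
    and small: "ennreal lam * radius_moment \<nu> CARD('d)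
        \<le> ennreal (1 / (4 * (card K)\<^sup>2 * unit_ball_vol CARD('d) * 125 ^ CARD('d)))"
  shows "diameter_moment P s < \<infinity>"
proof -
  interpret boolean_percolation P lam \<nu> using \<nu> lam P by unfold_locales
  define A where "A = (real (card K))\<^sup>2 * (lam * unit_ball_vol CARD('d))"
  have A: "0 \<le> A" using lam by (simp add: A_def unit_ball_vol_nonneg)
  \<comment> \<open>As \<open>d \<ge> 1\<close> and \<open>u \<le> 1\<close>, the volume factor \<open>u\<^sup>d\<close> is at most \<open>u\<close>, and \<open>A u \<le> 1/2\<close>.\<close>
  define u where "u = 1 / (1 + 2 * A)"
  have u: "0 < u" "u \<le> 1" "A * u \<le> 1/2" using A by (auto simp: u_def field_simps)
  have "u ^ CARD('d) \<le> u ^ 1" using u by (intro power_decreasing) (auto simp: Suc_le_eq)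
  then have "A * u ^ CARD('d) \<le> 1/2" using mult_left_mono[OF _ A, of "u ^ CARD('d)" u] u(3) by simp
  define \<eta> where "\<eta> = u / 24"
  have \<eta>: "0 < \<eta>" using u by (simp add: \<eta>_def)
  obtain D :: "nat \<Rightarrow> (real ^ 'd) \<times> real" where "(\<Union>n. ball (D n) \<eta>) = UNIV"
    using ex_countable_net[OF \<eta>] by blast
  then interpret discretised P lam \<nu> D \<eta> using \<eta> by unfold_locales
  show ?thesis
  proof (rule diameter_moment_finite_of_mesh[OF K s m small])
    show "(card K)\<^sup>2 * (lam * unit_ball_vol CARD('d) * (24 * \<eta>) ^ CARD('d)) \<le> 1/2"
      using \<open>A * u ^ CARD('d) \<le> 1/2\<close> by (simp add: A_def \<eta>_def mult.assoc)
  qed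
qed

lemma radius_moment_mono:
  assumes \<nu>: "radius_law \<nu>" and "0 \<le> p" "p \<le> p'" "radius_moment \<nu> p' < \<infinity>"
  shows "radius_moment \<nu> p < \<infinity>"
proof -
  interpret prob_space \<nu> using \<nu> by (simp add: radius_law_def)
  have [measurable]: "(\<lambda>r. ennreal (r powr p')) \<in> borel_measurable \<nu>"
    by (rule measurable_radius_law[OF \<nu>]) measurable
  have "radius_moment \<nu> p \<le> (\<integral>\<^sup>+ r. 1 + ennreal (r powr p') \<partial>\<nu>)"
    unfolding radius_moment_def
  proof (rule nn_integral_mono)
    fix r assume "r \<in> space \<nu>"
    then have r: "0 < r" by (simp add: space_radius_law[OF \<nu>])
    have "r powr p \<le> 1 + r powr p'"
    proof (cases "1 \<le> r")
      case True
      then have "r powr p \<le> r powr p'" using assms by (intro powr_mono) auto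
      then show ?thesis by simp
    next
      case False
      then show ?thesis using r assms powr_mono2[of p r 1] by (simp add: add_increasing2)
    qed
    then have "ennreal (r powr p) \<le> ennreal (1 + r powr p')" by (rule ennreal_leI)
    then show "ennreal (r powr p) \<le> 1 + ennreal (r powr p')" by simp
  qed
  also have "\<dots> = (\<integral>\<^sup>+ r. 1 \<partial>\<nu>) + radius_moment \<nu> p'"
    unfolding radius_moment_def by (rule nn_integral_add) measurable
  also have "\<dots> < \<infinity>" using assms by (simp add: emeasure_space_1)
  finally show ?thesis .
qed

theorem theorem2p2:
  shows
    "(\<forall>s::real. s > 0 \<longrightarrow>
       (\<forall>\<nu>. radius_law \<nu> \<longrightarrow>
         (\<forall>P :: real \<Rightarrow> ((real ^ 'd::finite) \<times> real) set measure.
           (\<forall>lam>0. boolean_model (P lam) lam \<nu>) \<longrightarrow>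
             (radius_moment \<nu> (real CARD('d) + s) < \<infinity>
              \<longleftrightarrow> (\<exists>lam0>0. \<forall>lam. 0 < lam \<and> lam < lam0 \<longrightarrow> diameter_moment (P lam) s < \<infinity>)))))
     \<and>
     (\<exists>C::real. C > 0 \<and>
       (\<forall>s::real. s > 0 \<longrightarrow>
         (\<forall>\<nu>. radius_law \<nu> \<longrightarrow>
           radius_moment \<nu> (real CARD('d) + s) < \<infinity> \<longrightarrow>
             (\<forall>lam::real. 0 < lam \<and> ennreal lam < ennreal C * inverse (radius_moment \<nu> (real CARD('d))) \<longrightarrow>
               (\<forall>P :: ((real ^ 'd::finite) \<times> real) set measure.
                  boolean_model P lam \<nu> \<longrightarrow> diameter_moment P s < \<infinity>)))))"
proof -
  obtain K :: "(real ^ 'd) set" where K: "finite K" "cball 0 30 \<subseteq> (\<Union>k\<in>K. ball k 1)"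
    using compact_cball[of "0 :: real ^ 'd" 30] unfolding compact_eq_totally_bounded
    by (meson zero_less_one)
  have "(0 :: real ^ 'd) \<in> cball 0 30" by simp
  then have Kne: "K \<noteq> {}" using K(2) by blast
  define C where "C = 1 / (4 * (card K)\<^sup>2 * unit_ball_vol CARD('d) * 125 ^ CARD('d))"
  have C: "0 < C" using K Kne by (simp add: C_def unit_ball_vol_pos card_gt_0_iff)
  have upper: "diameter_moment P s < \<infinity>"
    if "0 < s" "radius_law \<nu>" "radius_moment \<nu> (CARD('d) + s) < \<infinity>" "0 < lam"
      "ennreal lam * radius_moment \<nu> CARD('d) \<le> ennreal C" "boolean_model P lam \<nu>"
    for s lam :: real and \<nu> and P :: "((real ^ 'd) \<times> real) set measure"
    using diameter_moment_finite[OF that(2,4,6) K(1) Kne K(2) that(1,3)] that(5) by (simp add: C_def)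
  show ?thesis
  proof (intro conjI allI impI)
    fix s :: real and \<nu> and P :: "real \<Rightarrow> ((real ^ 'd) \<times> real) set measure"
    assume s: "0 < s" and \<nu>: "radius_law \<nu>" and P: "\<forall>lam>0. boolean_model (P lam) lam \<nu>"
    show "radius_moment \<nu> (real CARD('d) + s) < \<infinity>
        \<longleftrightarrow> (\<exists>lam0>0. \<forall>lam. 0 < lam \<and> lam < lam0 \<longrightarrow> diameter_moment (P lam) s < \<infinity>)"
    proof
      assume m: "radius_moment \<nu> (real CARD('d) + s) < \<infinity>"
      have "radius_moment \<nu> CARD('d) < \<infinity>"
        using s by (intro radius_moment_mono[OF \<nu> _ _ m]) auto
      then obtain x where x: "0 \<le> x" "radius_moment \<nu> CARD('d) = ennreal x"
        by (cases "radius_moment \<nu> CARD('d)") auto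
      have "diameter_moment (P lam) s < \<infinity>" if lam: "0 < lam" "lam < C / (x + 1)" for lam
      proof (rule upper[OF s \<nu> m lam(1)])
        have "lam * x \<le> lam * (x + 1)" using lam by simp
        also have "\<dots> \<le> C" using lam x by (simp add: field_simps)
        finally show "ennreal lam * radius_moment \<nu> CARD('d) \<le> ennreal C"
          unfolding x(2) using lam by (simp add: ennreal_leI flip: ennreal_mult')
        show "boolean_model (P lam) lam \<nu>" using P lam by blast
      qed
      then show "\<exists>lam0>0. \<forall>lam. 0 < lam \<and> lam < lam0 \<longrightarrow> diameter_moment (P lam) s < \<infinity>"
        using C x by (intro exI[of _ "C / (x + 1)"]) auto
    next
      assume "\<exists>lam0>0. \<forall>lam. 0 < lam \<and> lam < lam0 \<longrightarrow> diameter_moment (P lam) s < \<infinity>"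
      then obtain lam0 where lam0: "0 < lam0" "\<And>lam. 0 < lam \<Longrightarrow> lam < lam0 \<Longrightarrow> diameter_moment (P lam) s < \<infinity>"
        by blast
      interpret boolean_percolation "P (lam0 / 2)" "lam0 / 2" \<nu>
        using \<nu> P lam0(1) by unfold_locales auto
      show "radius_moment \<nu> (real CARD('d) + s) < \<infinity>"
        using lam0 by (intro radius_moment_finite[OF s]) auto
    qed
  next
    have "diameter_moment P s < \<infinity>"
      if s: "0 < s" and \<nu>: "radius_law \<nu>" and m: "radius_moment \<nu> (real CARD('d) + s) < \<infinity>"
        and lam: "0 < lam" "ennreal lam < ennreal C * inverse (radius_moment \<nu> (real CARD('d)))"
        and P: "boolean_model P lam \<nu>"
      for s lam :: real and \<nu> and P :: "((real ^ 'd) \<times> real) set measure"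
    proof (rule upper[OF s \<nu> m lam(1) _ P])
      have "radius_moment \<nu> CARD('d) < \<infinity>"
        using s by (intro radius_moment_mono[OF \<nu> _ _ m]) auto
      then obtain x where x: "0 \<le> x" "radius_moment \<nu> CARD('d) = ennreal x"
        by (cases "radius_moment \<nu> CARD('d)") auto
      show "ennreal lam * radius_moment \<nu> CARD('d) \<le> ennreal C"
      proof (cases "x = 0")
        case False
        then have "ennreal lam < ennreal (C / x)"
          using lam(2) x C by (simp add: inverse_ennreal divide_inverse ennreal_mult')
        then have "lam * x \<le> C" using lam(1) x False by (simp add: ennreal_less_iff field_simps)
        then show ?thesis
          unfolding x(2) using lam by (simp add: ennreal_leI flip: ennreal_mult')
      qed (simp add: x)
    qed
    then show "\<exists>C::real. C > 0 \<and>
       (\<forall>s::real. s > 0 \<longrightarrow>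
         (\<forall>\<nu>. radius_law \<nu> \<longrightarrow>
           radius_moment \<nu> (real CARD('d) + s) < \<infinity> \<longrightarrow>
             (\<forall>lam::real. 0 < lam \<and> ennreal lam < ennreal C * inverse (radius_moment \<nu> (real CARD('d))) \<longrightarrow>
               (\<forall>P :: ((real ^ 'd::finite) \<times> real) set measure.
                  boolean_model P lam \<nu> \<longrightarrow> diameter_moment P s < \<infinity>))))"
      using C by blast
  qed
qed

end
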